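(* The category $\bullet\text{-}\mathbf{FCov}$ (of $\bullet$-formal covers) is equivalent to $\lhd\text{-}\mathbf{FCov}$ (of $\lhd$-formal covers) and hence also to $\mathbf{FCov}$ (of formal covers) and to $\le\text{-}\mathbf{FCov}$ (of $\le$-formal covers).
   Context: A basic cover $(S,\lhd)$ on a set $S$ is a relation $\lhd$ between elements and subsets of $S$ such that $a\in U$ implies $a\lhd U$, and $a\lhd U$, $U\lhd V$ imply $a\lhd V$, where $U\lhd V$ means $b\lhd V$ for all $b\in U$. Put $\mathcal A U=\{a\in S\mid a\lhd U\}$; $U=_{\mathcal A}V$ means $\mathcal A U=\mathcal A V$. $Sat(\mathcal A)=\{U\subseteq S\mid U=\mathcal A U\}$ has joins $\bigvee^{\mathcal A}_i\mathcal A U_i=\mathcal A(\bigcup_iU_i)$. Elements are identified with singletons; $a\circ b=\{a\}\circ\{b\}$. For a relation $r$ between $S$ and $T$ and $V\subseteq T$, $r^-V=\{a\in S\mid\exists b\in V,\ a\,r\,b\}$. A basic cover map $r:(S,\lhd_S)\to(T,\lhd_T)$ is a relation between $S$ and $T$ such that $b\lhd_TV$ implies $r^-b\lhd_Sr^-V$; two are equal if $r_1^-b=_{\mathcal A_S}r_2^-b$ for all $b\in T$; composition is relational composition. A formal cover is $(S,\lhd,\circ)$ where $\lhd$ is a basic cover on $S$ and $\circ$ is a binary operation on $\mathcal P(S)$ such that: $U_1\lhd V_1$ and $U_2\lhd V_2$ imply $U_1\circ U_2\lhd V_1\circ V_2$; $(U\circ V)\circ W\lhd U\circ(V\circ W)$;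 $U\circ V\lhd V\circ U$; the operation $\mathcal A U\circ^{\mathcal A}\mathcal A V=\mathcal A(U\circ V)$ on $Sat(\mathcal A)$ distributes over arbitrary joins; and $\mathcal A(U\circ V)=\mathcal A U\cap\mathcal A V$ for all $U,V\subseteq S$. A formal cover map $r:(S,\lhd_S,\circ_S)\to(T,\lhd_T,\circ_T)$ is a basic cover map with $r^-(b_1\circ_Tb_2)=_{\mathcal A_S}(r^-b_1)\circ_S(r^-b_2)$ for all $b_1,b_2\in T$ and $r^-T=_{\mathcal A_S}S$; equality is equality of basic cover maps. $\mathbf{FCov}$ is the category of formal covers and formal cover maps. A $\bullet$-formal cover is a formal cover $(S,\lhd,\circ)$ together with a binary operation $\bullet:S\times S\to S$ such that $a\circ b=\{a\bullet b\}$ for all $a,b\in S$. $\bullet\text{-}\mathbf{FCov}$ is the full subcategory of $\mathbf{FCov}$ whose objects are $\bullet$-formal covers. For a preorder $\le$ on $S$, put $u\downarrow_\le v=\{a\in S\mid a\le u\text{ and }a\le v\}$ and $U\downarrow_\le V=\bigcup_{u\in U,v\in V}u\downarrow_\le v$. $(S,\lhd)$ is a $\lhd$-formal cover if, for the preorder $a\le b\Leftrightarrow a\lhd\{b\}$ and $\downarrow=\downarrow_\le$, one has: $a\lhd U$ and $a\lhd V$ imply $a\lhd U\downarrow V$ (equivalently, $(S,\lhd,\downarrow)$ is a formal cover); $\lhd\text{-}\mathbf{FCov}$ is the full subcategory of $\mathbf{FCov}$ on the formal covers of the form $(S,\lhd,\downarrow)$. A $\le$-formal cover is a basic cover $(S,\lhd)$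 with a preorder $\le$ on $S$ such that: $a\le b$ and $b\lhd U$ imply $a\lhd U$; and $a\lhd U$, $a\lhd V$ imply $a\lhd U\downarrow_\le V$. It is identified with the formal cover $(S,\lhd,\downarrow_\le)$, and $\le\text{-}\mathbf{FCov}$ is the full subcategory of $\mathbf{FCov}$ on these. *)

theory Defs
  imports Main
begin

section \<open>Categories and equivalence of categories\<close>

text \<open>
  Hom-sets are indexed by source and target and need not be disjoint, so identities, composition
  and the arrow part of a functor take the objects involved as arguments.
  \<open>Comp C X Y Z g f\<close> is the composite of \<open>f : X \<rightarrow> Y\<close> followed by \<open>g : Y \<rightarrow> Z\<close>.
\<close>

record ('o, 'm) cat =
  Ob :: "'o set"
  Hom :: "'o \<Rightarrow> 'o \<Rightarrow> 'm set"
  Id :: "'o \<Rightarrow> 'm"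
  Comp :: "'o \<Rightarrow> 'o \<Rightarrow> 'o \<Rightarrow> 'm \<Rightarrow> 'm \<Rightarrow> 'm"

definition category :: "('o, 'm) cat \<Rightarrow> bool" where
  "category C \<longleftrightarrow>
     (\<forall>X\<in>Ob C. Id C X \<in> Hom C X X) \<and>
     (\<forall>X\<in>Ob C. \<forall>Y\<in>Ob C. \<forall>Z\<in>Ob C. \<forall>f\<in>Hom C X Y. \<forall>g\<in>Hom C Y Z.
        Comp C X Y Z g f \<in> Hom C X Z) \<and>
     (\<forall>X\<in>Ob C. \<forall>Y\<in>Ob C. \<forall>f\<in>Hom C X Y.
        Comp C X X Y f (Id C X) = f \<and> Comp C X Y Y (Id C Y) f = f) \<and>
     (\<forall>W\<in>Ob C. \<forall>X\<in>Ob C. \<forall>Y\<in>Ob C. \<forall>Z\<in>Ob C.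
        \<forall>f\<in>Hom C W X. \<forall>g\<in>Hom C X Y. \<forall>h\<in>Hom C Y Z.
        Comp C W X Z (Comp C X Y Z h g) f = Comp C W Y Z h (Comp C W X Y g f))"

definition full_subcategory :: "('o, 'm) cat \<Rightarrow> ('o \<Rightarrow> bool) \<Rightarrow> ('o, 'm) cat" where
  "full_subcategory C P = C\<lparr>Ob := {X \<in> Ob C. P X}\<rparr>"

definition iso_arrow :: "('o, 'm) cat \<Rightarrow> 'o \<Rightarrow> 'o \<Rightarrow> 'm \<Rightarrow> bool" where
  "iso_arrow C X Y f \<longleftrightarrow> f \<in> Hom C X Y \<and>
     (\<exists>g\<in>Hom C Y X. Comp C X Y X g f = Id C X \<and> Comp C Y X Y f g = Id C Y)"

record ('o, 'm, 'p, 'n) cfunctor =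
  fob :: "'o \<Rightarrow> 'p"
  farr :: "'o \<Rightarrow> 'o \<Rightarrow> 'm \<Rightarrow> 'n"

definition is_functor :: "('o, 'm) cat \<Rightarrow> ('p, 'n) cat \<Rightarrow> ('o, 'm, 'p, 'n) cfunctor \<Rightarrow> bool" where
  "is_functor C D F \<longleftrightarrow>
     (\<forall>X\<in>Ob C. fob F X \<in> Ob D) \<and>
     (\<forall>X\<in>Ob C. \<forall>Y\<in>Ob C. \<forall>f\<in>Hom C X Y. farr F X Y f \<in> Hom D (fob F X) (fob F Y)) \<and>
     (\<forall>X\<in>Ob C. farr F X X (Id C X) = Id D (fob F X)) \<and>
     (\<forall>X\<in>Ob C. \<forall>Y\<in>Ob C. \<forall>Z\<in>Ob C. \<forall>f\<in>Hom C X Y. \<forall>g\<in>Hom C Y Z.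
        farr F X Z (Comp C X Y Z g f) =
        Comp D (fob F X) (fob F Y) (fob F Z) (farr F Y Z g) (farr F X Y f))"

definition id_functor :: "('o, 'm, 'o, 'm) cfunctor" where
  "id_functor = \<lparr>fob = (\<lambda>X. X), farr = (\<lambda>X Y f. f)\<rparr>"

definition comp_functor ::
  "('p, 'n, 'q, 'k) cfunctor \<Rightarrow> ('o, 'm, 'p, 'n) cfunctor \<Rightarrow> ('o, 'm, 'q, 'k) cfunctor" where
  "comp_functor G F =
     \<lparr>fob = (\<lambda>X. fob G (fob F X)),
      farr = (\<lambda>X Y f. farr G (fob F X) (fob F Y) (farr F X Y f))\<rparr>"

definition natural_iso ::
  "('o, 'm) cat \<Rightarrow> ('p, 'n) cat \<Rightarrow> ('o, 'm, 'p, 'n) cfunctor \<Rightarrow> ('o, 'm, 'p, 'n) cfunctor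
     \<Rightarrow> ('o \<Rightarrow> 'n) \<Rightarrow> bool" where
  "natural_iso C D F G \<eta> \<longleftrightarrow>
     (\<forall>X\<in>Ob C. iso_arrow D (fob F X) (fob G X) (\<eta> X)) \<and>
     (\<forall>X\<in>Ob C. \<forall>Y\<in>Ob C. \<forall>f\<in>Hom C X Y.
        Comp D (fob F X) (fob F Y) (fob G Y) (\<eta> Y) (farr F X Y f) =
        Comp D (fob F X) (fob G X) (fob G Y) (farr G X Y f) (\<eta> X))"

definition equivalent_categories :: "('o, 'm) cat \<Rightarrow> ('p, 'n) cat \<Rightarrow> bool" where
  "equivalent_categories C D \<longleftrightarrow> category C \<and> category D \<and>
     (\<exists>F G \<eta> \<epsilon>. is_functor C D F \<and> is_functor D C G \<and>
        natural_iso C C id_functor (comp_functor G F) \<eta> \<and>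
        natural_iso D D (comp_functor F G) id_functor \<epsilon>)"


section \<open>Basic covers\<close>

text \<open>
  A set \<open>S\<close> is a subset of an ambient type, and a cover on \<open>S\<close> only relates elements of \<open>S\<close> to
  subsets of \<open>S\<close>; thus equality in HOL is equality of covers on \<open>S\<close>. The ambient type stands in
  for the universe of sets; where closure of that universe under finite lists matters, the type has
  to be infinite.
\<close>

definition basic_cover :: "'a set \<Rightarrow> ('a \<Rightarrow> 'a set \<Rightarrow> bool) \<Rightarrow> bool" where
  "basic_cover S cv \<longleftrightarrow>
     (\<forall>a U. cv a U \<longrightarrow> a \<in> S \<and> U \<subseteq> S) \<and>
     (\<forall>U\<subseteq>S. \<forall>a\<in>U. cv a U) \<and>
     (\<forall>a\<in>S. \<forall>U\<subseteq>S. \<forall>V\<subseteq>S. cv a U \<longrightarrow> (\<forall>b\<in>U. cv b V) \<longrightarrow> cv a V)"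

definition covers :: "('a \<Rightarrow> 'a set \<Rightarrow> bool) \<Rightarrow> 'a set \<Rightarrow> 'a set \<Rightarrow> bool" where
  "covers cv U V \<longleftrightarrow> (\<forall>b\<in>U. cv b V)"

definition saturation :: "('a \<Rightarrow> 'a set \<Rightarrow> bool) \<Rightarrow> 'a set \<Rightarrow> 'a set" where
  "saturation cv U = {a. cv a U}"

definition Sat :: "'a set \<Rightarrow> ('a \<Rightarrow> 'a set \<Rightarrow> bool) \<Rightarrow> 'a set set" where
  "Sat S cv = {U. U \<subseteq> S \<and> U = saturation cv U}"

definition sat_join :: "('a \<Rightarrow> 'a set \<Rightarrow> bool) \<Rightarrow> 'a set set \<Rightarrow> 'a set" where
  "sat_join cv \<X> = saturation cv (\<Union>\<X>)"

text \<open>The inverse image \<open>r\<^sup>- V\<close> of a relation \<open>r\<close> is \<open>r\<inverse> `` V\<close>.\<close>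

definition basic_cover_map ::
  "'a set \<Rightarrow> ('a \<Rightarrow> 'a set \<Rightarrow> bool) \<Rightarrow> 'b set \<Rightarrow> ('b \<Rightarrow> 'b set \<Rightarrow> bool) \<Rightarrow> ('a \<times> 'b) set \<Rightarrow> bool" where
  "basic_cover_map S cv T cw r \<longleftrightarrow> r \<subseteq> S \<times> T \<and>
     (\<forall>b\<in>T. \<forall>V\<subseteq>T. cw b V \<longrightarrow> covers cv (r\<inverse> `` {b}) (r\<inverse> `` V))"

definition basic_map_eq ::
  "('a \<Rightarrow> 'a set \<Rightarrow> bool) \<Rightarrow> 'b set \<Rightarrow> ('a \<times> 'b) set \<Rightarrow> ('a \<times> 'b) set \<Rightarrow> bool" where
  "basic_map_eq cv T r s \<longleftrightarrow> (\<forall>b\<in>T. saturation cv (r\<inverse> `` {b}) = saturation cv (s\<inverse> `` {b}))"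


section \<open>Formal covers\<close>

record 'a fcover =
  base :: "'a set"
  cov :: "'a \<Rightarrow> 'a set \<Rightarrow> bool"
  circ :: "'a set \<Rightarrow> 'a set \<Rightarrow> 'a set"

text \<open>
  The operation \<open>\<circ>\<^sup>\<A>\<close>, to be applied to saturated sets: as \<open>X = \<A> X\<close> and \<open>Y = \<A> Y\<close> for these,
  \<open>\<A> X \<circ>\<^sup>\<A> \<A> Y = \<A> (X \<circ> Y)\<close> is its value at \<open>X\<close>, \<open>Y\<close>.
\<close>

definition sat_circ :: "'a fcover \<Rightarrow> 'a set \<Rightarrow> 'a set \<Rightarrow> 'a set" where
  "sat_circ X U V = saturation (cov X) (circ X U V)"

text \<open>
  The operation of a formal cover is an operation on the powerset of its base. Its values at
  other arguments are fixed to be empty, again so that equality in HOL is equality of structures.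
\<close>

definition formal_cover :: "'a fcover \<Rightarrow> bool" where
  "formal_cover X \<longleftrightarrow>
     basic_cover (base X) (cov X) \<and>
     (\<forall>U\<subseteq>base X. \<forall>V\<subseteq>base X. circ X U V \<subseteq> base X) \<and>
     (\<forall>U V. \<not> (U \<subseteq> base X \<and> V \<subseteq> base X) \<longrightarrow> circ X U V = {}) \<and>
     (\<forall>U1\<subseteq>base X. \<forall>V1\<subseteq>base X. \<forall>U2\<subseteq>base X. \<forall>V2\<subseteq>base X.
        covers (cov X) U1 V1 \<longrightarrow> covers (cov X) U2 V2 \<longrightarrow>
        covers (cov X) (circ X U1 U2) (circ X V1 V2)) \<and>
     (\<forall>U\<subseteq>base X. \<forall>V\<subseteq>base X. \<forall>W\<subseteq>base X.
        covers (cov X) (circ X (circ X U V) W) (circ X U (circ X V W))) \<and>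
     (\<forall>U\<subseteq>base X. \<forall>V\<subseteq>base X. covers (cov X) (circ X U V) (circ X V U)) \<and>
     (\<forall>U\<in>Sat (base X) (cov X). \<forall>\<V>\<subseteq>Sat (base X) (cov X).
        sat_circ X U (sat_join (cov X) \<V>) = sat_join (cov X) ((\<lambda>V. sat_circ X U V) ` \<V>) \<and>
        sat_circ X (sat_join (cov X) \<V>) U = sat_join (cov X) ((\<lambda>V. sat_circ X V U) ` \<V>)) \<and>
     (\<forall>U\<subseteq>base X. \<forall>V\<subseteq>base X.
        saturation (cov X) (circ X U V) = saturation (cov X) U \<inter> saturation (cov X) V)"

definition formal_cover_map :: "'a fcover \<Rightarrow> 'b fcover \<Rightarrow> ('a \<times> 'b) set \<Rightarrow> bool" where
  "formal_cover_map X Y r \<longleftrightarrow>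
     basic_cover_map (base X) (cov X) (base Y) (cov Y) r \<and>
     (\<forall>b1\<in>base Y. \<forall>b2\<in>base Y.
        saturation (cov X) (r\<inverse> `` circ Y {b1} {b2}) =
        saturation (cov X) (circ X (r\<inverse> `` {b1}) (r\<inverse> `` {b2}))) \<and>
     saturation (cov X) (r\<inverse> `` base Y) = saturation (cov X) (base X)"

definition fmap_eq :: "'a fcover \<Rightarrow> 'b fcover \<Rightarrow> (('a \<times> 'b) set \<times> ('a \<times> 'b) set) set" where
  "fmap_eq X Y = {(r, s). formal_cover_map X Y r \<and> formal_cover_map X Y s \<and>
     basic_map_eq (cov X) (base Y) r s}"

text \<open>
  Equality of formal cover maps is coarser than equality of relations, so arrows are equivalence
  classes of relations, composed by composing representatives.
\<close>

type_synonym 'a fcov_cat = "('a fcover, 'a rel set) cat"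

definition FCov :: "'a fcov_cat" where
  "FCov =
     \<lparr>Ob = {X. formal_cover X},
      Hom = (\<lambda>X Y. {r. formal_cover_map X Y r} // fmap_eq X Y),
      Id = (\<lambda>X. fmap_eq X X `` {Id_on (base X)}),
      Comp = (\<lambda>X Y Z g f. \<Union>r\<in>f. \<Union>s\<in>g. fmap_eq X Z `` {r O s})\<rparr>"


section \<open>The three full subcategories\<close>

definition bullet_formal_cover :: "'a fcover \<Rightarrow> ('a \<Rightarrow> 'a \<Rightarrow> 'a) \<Rightarrow> bool" where
  "bullet_formal_cover X dot \<longleftrightarrow> formal_cover X \<and>
     (\<forall>a\<in>base X. \<forall>b\<in>base X. dot a b \<in> base X \<and> circ X {a} {b} = {dot a b})"

definition bullet_FCov :: "'a fcov_cat" where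
  "bullet_FCov = full_subcategory FCov (\<lambda>X. \<exists>dot. bullet_formal_cover X dot)"

definition down :: "'a rel \<Rightarrow> 'a set \<Rightarrow> 'a set \<Rightarrow> 'a set" where
  "down le U V = (\<Union>u\<in>U. \<Union>v\<in>V. {a. (a, u) \<in> le \<and> (a, v) \<in> le})"

definition cov_preorder :: "'a set \<Rightarrow> ('a \<Rightarrow> 'a set \<Rightarrow> bool) \<Rightarrow> 'a rel" where
  "cov_preorder S cv = {(a, b). a \<in> S \<and> b \<in> S \<and> cv a {b}}"

definition tri_formal_cover :: "'a set \<Rightarrow> ('a \<Rightarrow> 'a set \<Rightarrow> bool) \<Rightarrow> bool" where
  "tri_formal_cover S cv \<longleftrightarrow> basic_cover S cv \<and>
     (\<forall>a\<in>S. \<forall>U\<subseteq>S. \<forall>V\<subseteq>S. cv a U \<longrightarrow> cv a V \<longrightarrow> cv a (down (cov_preorder S cv) U V))"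

definition le_formal_cover :: "'a set \<Rightarrow> ('a \<Rightarrow> 'a set \<Rightarrow> bool) \<Rightarrow> 'a rel \<Rightarrow> bool" where
  "le_formal_cover S cv le \<longleftrightarrow> basic_cover S cv \<and> preorder_on S le \<and>
     (\<forall>a b U. (a, b) \<in> le \<longrightarrow> cv b U \<longrightarrow> cv a U) \<and>
     (\<forall>a\<in>S. \<forall>U\<subseteq>S. \<forall>V\<subseteq>S. cv a U \<longrightarrow> cv a V \<longrightarrow> cv a (down le U V))"

text \<open>The triple \<open>(S, \<lhd>, \<down>\<^sub>\<le>)\<close>.\<close>

definition down_cover :: "'a set \<Rightarrow> ('a \<Rightarrow> 'a set \<Rightarrow> bool) \<Rightarrow> 'a rel \<Rightarrow> 'a fcover" where
  "down_cover S cv le =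
     \<lparr>base = S, cov = cv, circ = (\<lambda>U V. if U \<subseteq> S \<and> V \<subseteq> S then down le U V else {})\<rparr>"

definition tri_FCov :: "'a fcov_cat" where
  "tri_FCov = full_subcategory FCov
     (\<lambda>X. \<exists>S cv. tri_formal_cover S cv \<and> X = down_cover S cv (cov_preorder S cv))"

definition le_FCov :: "'a fcov_cat" where
  "le_FCov = full_subcategory FCov
     (\<lambda>X. \<exists>S cv le. le_formal_cover S cv le \<and> X = down_cover S cv le)"


text \<open>
  The condition \<open>X \<in> Ob FCov\<close> implicit in the last two definitions is automatically satisfied.
\<close>

lemma basic_coverD:
  assumes "basic_cover S cv"
  shows "cv a U \<Longrightarrow> a \<in> S" "cv a U \<Longrightarrow> U \<subseteq> S"
    and "U \<subseteq> S \<Longrightarrow> a \<in> U \<Longrightarrow> cv a U"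
    and "V \<subseteq> S \<Longrightarrow> cv a U \<Longrightarrow> covers cv U V \<Longrightarrow> cv a V"
proof -
  have 1: "\<forall>a U. cv a U \<longrightarrow> a \<in> S \<and> U \<subseteq> S" and 2: "\<forall>U\<subseteq>S. \<forall>a\<in>U. cv a U"
    and 3: "\<forall>a\<in>S. \<forall>U\<subseteq>S. \<forall>V\<subseteq>S. cv a U \<longrightarrow> (\<forall>b\<in>U. cv b V) \<longrightarrow> cv a V"
    using assms unfolding basic_cover_def by - (elim conjE, assumption)+
  show "cv a U \<Longrightarrow> a \<in> S" "cv a U \<Longrightarrow> U \<subseteq> S"
    using 1[rule_format, of a U] by blast+
  show "U \<subseteq> S \<Longrightarrow> a \<in> U \<Longrightarrow> cv a U"
    by (rule 2[rule_format])
  show "cv a V" if "V \<subseteq> S" "cv a U" "covers cv U V"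
    using 1[rule_format, OF that(2)] 3[rule_format, of a U V] that unfolding covers_def by blast
qed

lemma formal_cover_down_cover:
  assumes "le_formal_cover S cv le"
  shows "formal_cover (down_cover S cv le)"
proof -
  have bc: "basic_cover S cv" and le_sub: "le \<subseteq> S \<times> S"
    and loc: "\<And>a b U. (a, b) \<in> le \<Longrightarrow> cv b U \<Longrightarrow> cv a U"
    using assms unfolding le_formal_cover_def preorder_on_def by - (elim conjE; blast)+
  note dom = basic_coverD(1,2)[OF bc] and rfl = basic_coverD(3)[OF bc]
    and trn = basic_coverD(4)[OF bc]
  have conv: "cv a (down le U V)" if "cv a U" "cv a V" for a U V
  proof -
    have "\<forall>a\<in>S. \<forall>U\<subseteq>S. \<forall>V\<subseteq>S. cv a U \<longrightarrow> cv a V \<longrightarrow> cv a (down le U V)"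
      using assms unfolding le_formal_cover_def by (elim conjE)
    from this[rule_format, of a U V] show ?thesis
      using that dom[OF that(1)] dom[OF that(2)] by simp
  qed
  have down_sub: "down le U V \<subseteq> S" for U V
    using le_sub unfolding down_def by blast
  have down_comm: "down le U V = down le V U" for U V
    unfolding down_def by blast
  have sat_down: "cv a (down le U V) \<longleftrightarrow> cv a U \<and> cv a V" if "U \<subseteq> S" "V \<subseteq> S" for a U V
  proof -
    have "covers cv (down le U V) U" "covers cv (down le U V) V"
      unfolding covers_def down_def using loc rfl that by blast+
    then show ?thesis using conv trn that by blast
  qed
  have Union_sub: "\<Union>(saturation cv ` \<V>) \<subseteq> S" for \<V>
    using dom unfolding saturation_def by blast
  have dist: "cv a (down le U (\<Union>\<V>)) \<longleftrightarrow> cv a (\<Union>V\<in>\<V>. saturation cv (down le U V))"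
    if U: "U \<subseteq> S" and \<V>: "\<And>V. V \<in> \<V> \<Longrightarrow> V \<subseteq> S" for a U \<V>
  proof -
    have 1: "(\<Union>V\<in>\<V>. saturation cv (down le U V)) \<subseteq> S"
      using dom unfolding saturation_def by blast
    have 2: "covers cv (down le U (\<Union>\<V>)) (\<Union>V\<in>\<V>. saturation cv (down le U V))"
    proof (unfold covers_def, rule ballI)
      fix b assume "b \<in> down le U (\<Union>\<V>)"
      then obtain V where "V \<in> \<V>" "b \<in> down le U V" unfolding down_def by blast
      then have "b \<in> (\<Union>V\<in>\<V>. saturation cv (down le U V))"
        using rfl[OF down_sub] unfolding saturation_def by blast
      then show "cv b (\<Union>V\<in>\<V>. saturation cv (down le U V))" using rfl[OF 1] by blast
    qed
    have 3: "covers cv (\<Union>V\<in>\<V>. saturation cv (down le U V)) (down le U (\<Union>\<V>))"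
    proof (unfold covers_def, rule ballI)
      fix b assume "b \<in> (\<Union>V\<in>\<V>. saturation cv (down le U V))"
      then obtain V where "V \<in> \<V>" and b: "cv b (down le U V)" unfolding saturation_def by blast
      then have "covers cv (down le U V) (down le U (\<Union>\<V>))"
        using rfl[OF down_sub] unfolding covers_def down_def by blast
      then show "cv b (down le U (\<Union>\<V>))" using trn[OF down_sub b] by blast
    qed
    show ?thesis using trn[OF 1 _ 2] trn[OF down_sub _ 3] by blast
  qed
  let ?X = "down_cover S cv le"
  have X [simp]: "base ?X = S" "cov ?X = cv"
    "\<And>U V. circ ?X U V = (if U \<subseteq> S \<and> V \<subseteq> S then down le U V else {})"
    unfolding down_cover_def by simp_all
  have covD: "covers cv U1 V1 \<Longrightarrow> covers cv U2 V2 \<Longrightarrow> covers cv (down le U1 U2) (down le V1 V2)"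
    if "U1 \<subseteq> S" "V1 \<subseteq> S" "U2 \<subseteq> S" "V2 \<subseteq> S" for U1 V1 U2 V2
  proof -
    assume "covers cv U1 V1" "covers cv U2 V2"
    then have "cv b V1 \<and> cv b V2" if "b \<in> down le U1 U2" for b
      using that loc unfolding covers_def down_def by blast
    then show "covers cv (down le U1 U2) (down le V1 V2)"
      unfolding covers_def by (intro ballI) (simp only: sat_down \<open>V1 \<subseteq> S\<close> \<open>V2 \<subseteq> S\<close>)
  qed
  have assocD: "covers cv (down le (down le U V) W) (down le U (down le V W))"
    if "U \<subseteq> S" "V \<subseteq> S" "W \<subseteq> S" for U V W
    unfolding covers_def
  proof
    fix b assume "b \<in> down le (down le U V) W"
    then have "cv b (down le (down le U V) W)" by (rule rfl[OF down_sub])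
    then show "cv b (down le U (down le V W))"
      by (simp only: sat_down down_sub that)
  qed
  have commD: "covers cv (down le U V) (down le V U)" for U V
    unfolding covers_def using rfl[OF down_sub] down_comm by blast
  have joins: "sat_circ ?X U (sat_join cv \<V>) = sat_join cv ((\<lambda>V. sat_circ ?X U V) ` \<V>)"
    "sat_circ ?X (sat_join cv \<V>) U = sat_join cv ((\<lambda>V. sat_circ ?X V U) ` \<V>)"
    if U: "U \<in> Sat S cv" and \<V>: "\<V> \<subseteq> Sat S cv" for U \<V>
  proof -
    have U': "U \<subseteq> S" and \<V>': "\<And>V. V \<in> \<V> \<Longrightarrow> V \<subseteq> S" using U \<V> unfolding Sat_def by blast+
    have un: "\<Union>\<V> \<subseteq> S" using \<V>' by blast
    have j: "saturation cv (\<Union>\<V>) \<subseteq> S" using dom unfolding saturation_def by blast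
    have idem: "cv a (saturation cv (\<Union>\<V>)) \<longleftrightarrow> cv a (\<Union>\<V>)" for a
      using trn[OF un, of a "saturation cv (\<Union>\<V>)"] trn[OF j, of a "\<Union>\<V>"] rfl[OF un] rfl[OF j]
      unfolding covers_def saturation_def by blast
    have im: "(\<lambda>V. sat_circ ?X U V) ` \<V> = (\<lambda>V. saturation cv (down le U V)) ` \<V>"
      "(\<lambda>V. sat_circ ?X V U) ` \<V> = (\<lambda>V. saturation cv (down le U V)) ` \<V>"
      using U' \<V>' by (auto intro!: image_cong simp: sat_circ_def down_comm[of _ U])
    have "saturation cv (down le U (saturation cv (\<Union>\<V>))) = saturation cv (down le U (\<Union>\<V>))"
      unfolding saturation_def[of cv "down le U _"]
      by (simp only: sat_down[OF U' un] sat_down[OF U' j] idem)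
    also have "\<dots> = saturation cv (\<Union>V\<in>\<V>. saturation cv (down le U V))"
      using dist[OF U' \<V>'] unfolding saturation_def by simp
    finally have *: "saturation cv (down le U (saturation cv (\<Union>\<V>))) =
      saturation cv (\<Union>V\<in>\<V>. saturation cv (down le U V))" .
    show "sat_circ ?X U (sat_join cv \<V>) = sat_join cv ((\<lambda>V. sat_circ ?X U V) ` \<V>)"
      unfolding im sat_join_def using * U' j by (simp add: sat_circ_def)
    show "sat_circ ?X (sat_join cv \<V>) U = sat_join cv ((\<lambda>V. sat_circ ?X V U) ` \<V>)"
      unfolding im sat_join_def using * U' j by (simp add: sat_circ_def down_comm[of _ U])
  qed
  have emp: "circ ?X U V = {}" if "\<not> (U \<subseteq> S \<and> V \<subseteq> S)" for U V
    using that by auto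
  have circ: "circ ?X U V = down le U V" if "U \<subseteq> S" "V \<subseteq> S" for U V
    using that by simp
  show ?thesis
    unfolding formal_cover_def X(1,2)
    apply (intro conjI allI impI ballI)
    subgoal by (rule bc)
    subgoal by (simp only: circ down_sub)
    subgoal by (rule emp)
    subgoal by (simp only: circ covD)
    subgoal by (simp only: circ down_sub assocD)
    subgoal by (simp only: circ commD)
    subgoal by (rule joins)
    subgoal by (rule joins)
    subgoal using sat_down by (simp only: circ saturation_def Collect_conj_eq)
    done
qed

lemma tri_formal_cover_imp_le:
  assumes "tri_formal_cover S cv"
  shows "le_formal_cover S cv (cov_preorder S cv)"
proof -
  have bc: "basic_cover S cv" using assms unfolding tri_formal_cover_def by blast
  note dom = basic_coverD(1,2)[OF bc] and rfl = basic_coverD(3)[OF bc]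
    and trn = basic_coverD(4)[OF bc]
  have loc: "cv a U" if "(a, b) \<in> cov_preorder S cv" "cv b U" for a b U
  proof -
    have "cv a {b}" "covers cv {b} U" "U \<subseteq> S"
      using that dom[OF that(2)] unfolding cov_preorder_def covers_def by simp_all
    then show ?thesis by (intro trn[of U a "{b}"])
  qed
  have "preorder_on S (cov_preorder S cv)"
    unfolding preorder_on_def
  proof (intro conjI)
    show "cov_preorder S cv \<subseteq> S \<times> S" unfolding cov_preorder_def by auto
    show "refl_on S (cov_preorder S cv)"
      using rfl unfolding refl_on_def cov_preorder_def by simp
    show "trans (cov_preorder S cv)"
    proof (rule transI)
      fix a b c assume *: "(a, b) \<in> cov_preorder S cv" "(b, c) \<in> cov_preorder S cv"
      then have "cv a {c}" using loc[OF *(1)] unfolding cov_preorder_def by simp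
      then show "(a, c) \<in> cov_preorder S cv" using * unfolding cov_preorder_def by simp
    qed
  qed
  moreover have "\<forall>a\<in>S. \<forall>U\<subseteq>S. \<forall>V\<subseteq>S. cv a U \<longrightarrow> cv a V \<longrightarrow> cv a (down (cov_preorder S cv) U V)"
    using assms unfolding tri_formal_cover_def by (elim conjE)
  moreover have "\<forall>a b U. (a, b) \<in> cov_preorder S cv \<longrightarrow> cv b U \<longrightarrow> cv a U"
    by (intro allI impI) (rule loc)
  ultimately show ?thesis
    unfolding le_formal_cover_def using bc by (intro conjI)
qed

end

theory Submission
  imports "HOL-Algebra.Free_Abelian_Groups" Defs
begin

text \<open>
  All four categories are full subcategories of \<open>FCov\<close>, and two full subcategories of one category
  are equivalent as soon as each object of either is isomorphic to an object of the other
  (\<open>equivalent_full_subcategories\<close>). So it is enough that every formal cover \<open>X\<close> is isomorphic in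
  \<open>FCov\<close> to a \<open>\<lhd>\<close>-formal cover, which is in particular a \<open>\<le>\<close>-formal cover, and to a
  \<open>\<bullet>\<close>-formal cover.

  The equation \<open>\<A>(U \<circ> V) = \<A> U \<inter> \<A> V\<close> says that \<open>\<circ>\<close> is the meet of saturated subsets, so \<open>\<circ>\<close> is
  determined by the cover up to \<open>=\<^sub>\<A>\<close>. Distributivity makes the saturated subsets a frame, whence
  \<open>\<A> U \<inter> \<A> V\<close> is the join of the sets \<open>\<A>{u} \<inter> \<A>{v}\<close>; and \<open>\<A>{u} \<inter> \<A>{v}\<close> is \<open>u \<down> v\<close> for
  the preorder \<open>a \<lhd> {b}\<close>. Therefore the base and cover of \<open>X\<close> already form a \<open>\<lhd>\<close>-formal cover
  (\<open>formal_cover_imp_tri\<close>), and the identity relation is an isomorphism onto it. Conversely, a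
  \<open>\<lhd>\<close>-formal cover with any operation that computes the meets is a formal cover
  (\<open>formal_cover_iff\<close>).

  For a \<open>\<bullet>\<close>-formal cover the generators have to be closed under binary meets. Take as new generators
  the finite nonempty subsets \<open>F\<close> of the base, where \<open>F\<close> stands for the saturated subset
  \<open>\<Inter>x\<in>F. \<A>{x}\<close>, let a generator be covered by others when its saturated subset lies in the join of
  theirs, and let \<open>\<bullet>\<close> be union. The result presents the same frame as \<open>X\<close>, with the membership
  relation between points and generators as an isomorphism (locale \<open>meet_generators\<close>). Finite subsets
  of the base are coded by elements of the ambient type, which is possible because that type is
  infinite.
\<close>

section \<open>Full subcategories with the same isomorphism classes\<close>

lemma category_id: "category C \<Longrightarrow> X \<in> Ob C \<Longrightarrow> Id C X \<in> Hom C X X"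
  unfolding category_def by blast

lemma category_comp:
  "category C \<Longrightarrow> f \<in> Hom C X Y \<Longrightarrow> g \<in> Hom C Y Z \<Longrightarrow> X \<in> Ob C \<Longrightarrow> Y \<in> Ob C \<Longrightarrow> Z \<in> Ob C
    \<Longrightarrow> Comp C X Y Z g f \<in> Hom C X Z"
  unfolding category_def by blast

lemma category_unit:
  assumes "category C" "f \<in> Hom C X Y" "X \<in> Ob C" "Y \<in> Ob C"
  shows "Comp C X X Y f (Id C X) = f" "Comp C X Y Y (Id C Y) f = f"
  using assms unfolding category_def by blast+

lemma category_assoc:
  assumes "category C" "f \<in> Hom C W X" "g \<in> Hom C X Y" "h \<in> Hom C Y Z"
    "W \<in> Ob C" "X \<in> Ob C" "Y \<in> Ob C" "Z \<in> Ob C"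
  shows "Comp C W X Z (Comp C X Y Z h g) f = Comp C W Y Z h (Comp C W X Y g f)"
  using assms unfolding category_def by blast

lemma full_subcategory_simps [simp]:
  "Ob (full_subcategory C P) = {X \<in> Ob C. P X}"
  "Hom (full_subcategory C P) = Hom C"
  "Id (full_subcategory C P) = Id C"
  "Comp (full_subcategory C P) = Comp C"
  unfolding full_subcategory_def by simp_all

lemma category_full_subcategory: "category C \<Longrightarrow> category (full_subcategory C P)"
  unfolding category_def by simp

definition inverse_arrows ::
  "('o, 'm) cat \<Rightarrow> 'o \<Rightarrow> 'o \<Rightarrow> 'm \<Rightarrow> 'm \<Rightarrow> bool" where
  "inverse_arrows C X Y f g \<longleftrightarrow> f \<in> Hom C X Y \<and> g \<in> Hom C Y X \<and>
     Comp C X Y X g f = Id C X \<and> Comp C Y X Y f g = Id C Y"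

lemma iso_arrow_iff: "iso_arrow C X Y f \<longleftrightarrow> (\<exists>g. inverse_arrows C X Y f g)"
  unfolding iso_arrow_def inverse_arrows_def by blast

lemma inverse_arrows_sym: "inverse_arrows C X Y f g \<Longrightarrow> inverse_arrows C Y X g f"
  unfolding inverse_arrows_def by blast

lemma inverse_arrows_full_subcategory [simp]:
  "inverse_arrows (full_subcategory C P) = inverse_arrows C"
  unfolding inverse_arrows_def fun_eq_iff by simp

lemma inverse_arrows_cancel:
  assumes "category C" "inverse_arrows C X Y e d" "W \<in> Ob C" "X \<in> Ob C" "Y \<in> Ob C"
    and "f \<in> Hom C W X"
  shows "Comp C W Y X d (Comp C W X Y e f) = f"
proof -
  have "e \<in> Hom C X Y" "d \<in> Hom C Y X" "Comp C X Y X d e = Id C X"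
    using assms(2) unfolding inverse_arrows_def by blast+
  then show ?thesis
    using category_assoc[OF assms(1,6), where g = e and h = d and Y = Y and Z = X] category_unit(2)[OF assms(1,6)] assms by simp
qed

lemma inverse_arrows_comp:
  assumes "category C" "X \<in> Ob C" "Y \<in> Ob C" "Z \<in> Ob C"
    and "inverse_arrows C X Y e d" "inverse_arrows C Y Z e' d'"
  shows "inverse_arrows C X Z (Comp C X Y Z e' e) (Comp C Z Y X d d')"
proof -
  have e: "e \<in> Hom C X Y" "d \<in> Hom C Y X" "e' \<in> Hom C Y Z" "d' \<in> Hom C Z Y"
    and id: "Comp C X Y X d e = Id C X" "Comp C Z Y Z e' d' = Id C Z"
    using assms(5,6) unfolding inverse_arrows_def by blast+
  note rules = category_comp[OF assms(1)] category_assoc[OF assms(1)] assms(2-4) e id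
    inverse_arrows_cancel[OF assms(1) assms(6)]
    inverse_arrows_cancel[OF assms(1) inverse_arrows_sym[OF assms(5)]]
  show ?thesis unfolding inverse_arrows_def by (simp add: rules)
qed

text \<open>
  Arrows are transported along a chosen isomorphism \<open>e X\<close> from each object \<open>X\<close> to \<open>H X\<close>, with inverse
  \<open>d X\<close>.
\<close>

definition conjugate ::
  "('o, 'm) cat \<Rightarrow> ('o \<Rightarrow> 'o) \<Rightarrow> ('o \<Rightarrow> 'm) \<Rightarrow> ('o \<Rightarrow> 'm) \<Rightarrow> ('o, 'm, 'o, 'm) cfunctor" where
  "conjugate C H e d = \<lparr>fob = H,
     farr = (\<lambda>X Y f. Comp C (H X) Y (H Y) (e Y) (Comp C (H X) X Y f (d X)))\<rparr>"

text \<open>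
  Functoriality comes down to cancelling \<open>d Y \<circ> e Y\<close> in the middle of a composite.
\<close>

lemma is_functor_conjugate:
  assumes C: "category C"
    and H: "\<And>X. X \<in> Ob C \<Longrightarrow> P X \<Longrightarrow> H X \<in> Ob C \<and> Q (H X)"
    and e: "\<And>X. X \<in> Ob C \<Longrightarrow> P X \<Longrightarrow> inverse_arrows C X (H X) (e X) (d X)"
  shows "is_functor (full_subcategory C P) (full_subcategory C Q) (conjugate C H e d)"
proof -
  have e': "e X \<in> Hom C X (H X)" "d X \<in> Hom C (H X) X" "Comp C (H X) X (H X) (e X) (d X) = Id C (H X)"
    if "X \<in> Ob C" "P X" for X
    using e[OF that] unfolding inverse_arrows_def by blast+
  note rules = category_comp[OF C] category_assoc[OF C] category_unit[OF C] category_id[OF C] H e'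
    inverse_arrows_cancel[OF C e]
  show ?thesis
    unfolding is_functor_def conjugate_def by (simp add: rules)
qed

text \<open>
  A functor that acts on arrows by conjugation is isomorphic to the identity: the naturality square
  of \<open>e\<close> is the defining formula with \<open>d X\<close> moved to the other side. The functor
  \<open>T\<close> is compared with a conjugation on objects and arrows of \<open>C\<close> only, because a composite of two
  conjugations agrees with the conjugation by the composite isomorphisms only there.
\<close>

lemma natural_iso_conjugate:
  assumes C: "category C"
    and H: "\<And>X. X \<in> Ob C \<Longrightarrow> fob T X = H X \<and> H X \<in> Ob C"
    and e: "\<And>X. X \<in> Ob C \<Longrightarrow> inverse_arrows C X (H X) (e X) (d X)"
    and T: "\<And>X Y f. X \<in> Ob C \<Longrightarrow> Y \<in> Ob C \<Longrightarrow> f \<in> Hom C X Y \<Longrightarrow>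
      farr T X Y f = farr (conjugate C H e d) X Y f"
  shows "natural_iso C C id_functor T e" and "natural_iso C C T id_functor d"
proof -
  have e': "e X \<in> Hom C X (H X)" "d X \<in> Hom C (H X) X" "Comp C X (H X) X (d X) (e X) = Id C X"
    if "X \<in> Ob C" for X
    using e[OF that] unfolding inverse_arrows_def by blast+
  have iso: "iso_arrow C X (H X) (e X)" "iso_arrow C (H X) X (d X)" if "X \<in> Ob C" for X
    using e[OF that] inverse_arrows_sym[OF e[OF that]] unfolding iso_arrow_iff by blast+
  note rules = category_comp[OF C] category_assoc[OF C] category_unit[OF C] H e' T iso
    inverse_arrows_cancel[OF C e]
  show "natural_iso C C id_functor T e" "natural_iso C C T id_functor d"
    unfolding natural_iso_def id_functor_def by (simp_all add: rules conjugate_def)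
qed

text \<open>
  Choose isomorphisms in both directions. The functors are the two conjugations, and each of their
  composites is conjugation by a composite isomorphism.
\<close>

theorem equivalent_full_subcategories:
  assumes C: "category C"
    and PQ: "\<And>X. X \<in> Ob C \<Longrightarrow> P X \<Longrightarrow> \<exists>Y\<in>Ob C. Q Y \<and> (\<exists>f. iso_arrow C X Y f)"
    and QP: "\<And>X. X \<in> Ob C \<Longrightarrow> Q X \<Longrightarrow> \<exists>Y\<in>Ob C. P Y \<and> (\<exists>f. iso_arrow C X Y f)"
  shows "equivalent_categories (full_subcategory C P) (full_subcategory C Q)"
proof -
  obtain H e d where H: "\<And>X. X \<in> Ob C \<Longrightarrow> P X \<Longrightarrow> H X \<in> Ob C \<and> Q (H X)"
    and e: "\<And>X. X \<in> Ob C \<Longrightarrow> P X \<Longrightarrow> inverse_arrows C X (H X) (e X) (d X)"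
    using PQ unfolding iso_arrow_iff by metis
  obtain K e' d' where K: "\<And>X. X \<in> Ob C \<Longrightarrow> Q X \<Longrightarrow> K X \<in> Ob C \<and> P (K X)"
    and e': "\<And>X. X \<in> Ob C \<Longrightarrow> Q X \<Longrightarrow> inverse_arrows C X (K X) (e' X) (d' X)"
    using QP unfolding iso_arrow_iff by metis
  let ?P = "full_subcategory C P" and ?Q = "full_subcategory C Q"
  let ?F = "conjugate C H e d" and ?G = "conjugate C K e' d'"
  have hom: "e X \<in> Hom C X (H X)" "d X \<in> Hom C (H X) X" if "X \<in> Ob C" "P X" for X
    using e[OF that] unfolding inverse_arrows_def by blast+
  have hom': "e' X \<in> Hom C X (K X)" "d' X \<in> Hom C (K X) X" if "X \<in> Ob C" "Q X" for X
    using e'[OF that] unfolding inverse_arrows_def by blast+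
  let ?eP = "\<lambda>X. Comp C X (H X) (K (H X)) (e' (H X)) (e X)"
    and ?dP = "\<lambda>X. Comp C (K (H X)) (H X) X (d X) (d' (H X))"
  have "natural_iso ?P ?P id_functor (comp_functor ?G ?F) ?eP"
  proof (rule natural_iso_conjugate(1)[where H = "\<lambda>X. K (H X)" and d = ?dP])
    show "category ?P" by (rule category_full_subcategory[OF C])
    show "fob (comp_functor ?G ?F) X = K (H X) \<and> K (H X) \<in> Ob ?P" if "X \<in> Ob ?P" for X
      using that H K by (simp add: comp_functor_def conjugate_def)
    show "inverse_arrows ?P X (K (H X)) (?eP X) (?dP X)" if "X \<in> Ob ?P" for X
      using that H K e e' by (simp add: inverse_arrows_comp[OF C])
    show "farr (comp_functor ?G ?F) X Y f = farr (conjugate ?P (\<lambda>X. K (H X)) ?eP ?dP) X Y f"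
      if "X \<in> Ob ?P" "Y \<in> Ob ?P" "f \<in> Hom ?P X Y" for X Y f
      using that H[of X] H[of Y] K[of "H X"] K[of "H Y"] hom[of X] hom[of Y] hom'[of "H X"] hom'[of "H Y"]
      by (simp add: comp_functor_def conjugate_def category_comp[OF C] category_assoc[OF C])
  qed
  moreover let ?eQ = "\<lambda>X. Comp C X (K X) (H (K X)) (e (K X)) (e' X)"
    and ?dQ = "\<lambda>X. Comp C (H (K X)) (K X) X (d' X) (d (K X))"
  have "natural_iso ?Q ?Q (comp_functor ?F ?G) id_functor ?dQ"
  proof (rule natural_iso_conjugate(2)[where H = "\<lambda>X. H (K X)" and e = ?eQ])
    show "category ?Q" by (rule category_full_subcategory[OF C])
    show "fob (comp_functor ?F ?G) X = H (K X) \<and> H (K X) \<in> Ob ?Q" if "X \<in> Ob ?Q" for X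
      using that H K by (simp add: comp_functor_def conjugate_def)
    show "inverse_arrows ?Q X (H (K X)) (?eQ X) (?dQ X)" if "X \<in> Ob ?Q" for X
      using that H K e e' by (simp add: inverse_arrows_comp[OF C])
    show "farr (comp_functor ?F ?G) X Y f = farr (conjugate ?Q (\<lambda>X. H (K X)) ?eQ ?dQ) X Y f"
      if "X \<in> Ob ?Q" "Y \<in> Ob ?Q" "f \<in> Hom ?Q X Y" for X Y f
      using that K[of X] K[of Y] H[of "K X"] H[of "K Y"] hom'[of X] hom'[of Y] hom[of "K X"] hom[of "K Y"]
      by (simp add: comp_functor_def conjugate_def category_comp[OF C] category_assoc[OF C])
  qed
  ultimately show ?thesis
    unfolding equivalent_categories_def
    using category_full_subcategory[OF C] is_functor_conjugate[OF C H e]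
      is_functor_conjugate[OF C K e'] by blast
qed

section \<open>The frame of saturated subsets\<close>

abbreviation sat :: "'a fcover \<Rightarrow> 'a set \<Rightarrow> 'a set" where
  "sat X \<equiv> saturation (cov X)"

lemma
  assumes "basic_cover S cv"
  shows saturation_subset: "saturation cv U \<subseteq> S"
    and saturation_extensive: "U \<subseteq> S \<Longrightarrow> U \<subseteq> saturation cv U"
    and saturation_least: "V \<subseteq> S \<Longrightarrow> U \<subseteq> saturation cv V \<Longrightarrow> saturation cv U \<subseteq> saturation cv V"
proof -
  show "saturation cv U \<subseteq> S"
    unfolding saturation_def using basic_coverD(1)[OF assms] by blast
  show "U \<subseteq> saturation cv U" if "U \<subseteq> S"
    unfolding saturation_def using basic_coverD(3)[OF assms that] by blast
  show "saturation cv U \<subseteq> saturation cv V" if "V \<subseteq> S" "U \<subseteq> saturation cv V"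
    using basic_coverD(4)[OF assms that(1), of _ U] that(2) unfolding saturation_def covers_def by blast
qed

lemma covers_iff: "covers cv U V \<longleftrightarrow> U \<subseteq> saturation cv V"
  unfolding covers_def saturation_def by blast

lemma saturation_mono:
  assumes "basic_cover S cv" "U \<subseteq> V" "V \<subseteq> S"
  shows "saturation cv U \<subseteq> saturation cv V"
  by (rule saturation_least[OF assms(1,3) subset_trans[OF assms(2) saturation_extensive[OF assms(1,3)]]])

lemma saturation_idem:
  assumes "basic_cover S cv" "U \<subseteq> S"
  shows "saturation cv (saturation cv U) = saturation cv U"
  by (intro equalityI saturation_least[OF assms subset_refl]
      saturation_extensive[OF assms(1) saturation_subset[OF assms(1)]])

lemma down_cov_preorder:
  assumes "basic_cover S cv" "U \<subseteq> S" "V \<subseteq> S"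
  shows "down (cov_preorder S cv) U V = (\<Union>u\<in>U. \<Union>v\<in>V. saturation cv {u} \<inter> saturation cv {v})"
proof -
  have "{a. (a, u) \<in> cov_preorder S cv \<and> (a, v) \<in> cov_preorder S cv} =
      saturation cv {u} \<inter> saturation cv {v}" if "u \<in> S" "v \<in> S" for u v
    using that basic_coverD(1)[OF assms(1), of _ "{u}"]
    unfolding cov_preorder_def saturation_def by auto
  then show ?thesis
    unfolding down_def using assms(2,3) by (intro SUP_cong refl) (simp add: subset_iff)
qed

text \<open>
  In terms of saturations, convergence of \<open>\<down>\<close> is the nontrivial half of the law
  \<open>\<A> U \<inter> \<A> V = \<Squnion>u\<in>U. \<Squnion>v\<in>V. \<A>{u} \<inter> \<A>{v}\<close>, with joins computed as saturated unions.
\<close>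

lemma tri_formal_cover_iff:
  "tri_formal_cover S cv \<longleftrightarrow> basic_cover S cv \<and>
     (\<forall>U\<subseteq>S. \<forall>V\<subseteq>S. saturation cv U \<inter> saturation cv V \<subseteq>
        saturation cv (\<Union>u\<in>U. \<Union>v\<in>V. saturation cv {u} \<inter> saturation cv {v}))"
proof (cases "basic_cover S cv")
  case True
  have "(\<forall>a\<in>S. cv a U \<longrightarrow> cv a V \<longrightarrow> cv a (down (cov_preorder S cv) U V)) \<longleftrightarrow>
      saturation cv U \<inter> saturation cv V \<subseteq>
        saturation cv (\<Union>u\<in>U. \<Union>v\<in>V. saturation cv {u} \<inter> saturation cv {v})"
    if "U \<subseteq> S" "V \<subseteq> S" for U V
    unfolding down_cov_preorder[OF True that, symmetric]
    using basic_coverD(1)[OF True] unfolding saturation_def by blast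
  moreover have "(\<forall>a\<in>S. \<forall>U\<subseteq>S. \<forall>V\<subseteq>S. R a U V) \<longleftrightarrow> (\<forall>U\<subseteq>S. \<forall>V\<subseteq>S. \<forall>a\<in>S. R a U V)" for R
    by blast
  ultimately show ?thesis
    unfolding tri_formal_cover_def using True by simp
next
  case False
  then show ?thesis unfolding tri_formal_cover_def by blast
qed

lemma formal_coverD:
  assumes "formal_cover X"
  shows "basic_cover (base X) (cov X)"
    and "U \<subseteq> base X \<Longrightarrow> V \<subseteq> base X \<Longrightarrow> circ X U V \<subseteq> base X"
    and "\<not> (U \<subseteq> base X \<and> V \<subseteq> base X) \<Longrightarrow> circ X U V = {}"
    and "U \<subseteq> base X \<Longrightarrow> V \<subseteq> base X \<Longrightarrow> sat X (circ X U V) = sat X U \<inter> sat X V"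
    and "U \<in> Sat (base X) (cov X) \<Longrightarrow> \<V> \<subseteq> Sat (base X) (cov X) \<Longrightarrow>
      sat_circ X U (sat_join (cov X) \<V>) = sat_join (cov X) ((\<lambda>V. sat_circ X U V) ` \<V>)"
proof -
  have 1: "basic_cover (base X) (cov X)"
    and 2: "\<forall>U\<subseteq>base X. \<forall>V\<subseteq>base X. circ X U V \<subseteq> base X"
    and 3: "\<forall>U V. \<not> (U \<subseteq> base X \<and> V \<subseteq> base X) \<longrightarrow> circ X U V = {}"
    and 4: "\<forall>U\<subseteq>base X. \<forall>V\<subseteq>base X. sat X (circ X U V) = sat X U \<inter> sat X V"
    and 5: "\<forall>U\<in>Sat (base X) (cov X). \<forall>\<V>\<subseteq>Sat (base X) (cov X).
        sat_circ X U (sat_join (cov X) \<V>) = sat_join (cov X) ((\<lambda>V. sat_circ X U V) ` \<V>) \<and>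
        sat_circ X (sat_join (cov X) \<V>) U = sat_join (cov X) ((\<lambda>V. sat_circ X V U) ` \<V>)"
    using assms unfolding formal_cover_def by - (elim conjE, assumption)+
  show "basic_cover (base X) (cov X)" by (rule 1)
  show "U \<subseteq> base X \<Longrightarrow> V \<subseteq> base X \<Longrightarrow> circ X U V \<subseteq> base X" by (rule 2[rule_format])
  show "\<not> (U \<subseteq> base X \<and> V \<subseteq> base X) \<Longrightarrow> circ X U V = {}" by (rule 3[rule_format])
  show "U \<subseteq> base X \<Longrightarrow> V \<subseteq> base X \<Longrightarrow> sat X (circ X U V) = sat X U \<inter> sat X V"
    by (rule 4[rule_format])
  show "U \<in> Sat (base X) (cov X) \<Longrightarrow> \<V> \<subseteq> Sat (base X) (cov X) \<Longrightarrow>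
      sat_circ X U (sat_join (cov X) \<V>) = sat_join (cov X) ((\<lambda>V. sat_circ X U V) ` \<V>)"
    using 5 by blast
qed

text \<open>
  Every saturated subset is the join of the saturations of its points, and \<open>\<circ>\<^sup>\<A>\<close>, which is
  intersection, distributes over this join. Doing this in both arguments reduces \<open>\<A> U \<inter> \<A> V\<close> to
  pairs of points.
\<close>

lemma formal_cover_imp_tri:
  assumes X: "formal_cover X"
  shows "tri_formal_cover (base X) (cov X)"
  unfolding tri_formal_cover_iff
proof (intro conjI allI impI)
  show bc: "basic_cover (base X) (cov X)" by (rule formal_coverD(1)[OF X])
  note sub = saturation_subset[OF bc] and ext = saturation_extensive[OF bc]
    and least = saturation_least[OF bc] and mono = saturation_mono[OF bc]
  \<comment> \<open>distributivity in one argument, stated for an intersection instead of \<open>\<circ>\<^sup>\<A>\<close>\<close>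
  have frame: "U \<inter> sat X V \<subseteq> sat X (\<Union>v\<in>V. U \<inter> sat X {v})"
    if U: "U \<subseteq> base X" "sat X U = U" and V: "V \<subseteq> base X" for U V
  proof -
    let ?\<V> = "(\<lambda>v. sat X {v}) ` V"
    have idem: "sat X (sat X {v}) = sat X {v}" if "v \<in> V" for v
      using saturation_idem[OF bc, of "{v}"] that V by blast
    have UV: "sat_circ X U W = U \<inter> W" if "W \<subseteq> base X" "sat X W = W" for W
      using formal_coverD(4)[OF X U(1) that(1)] that U unfolding sat_circ_def by simp
    have "V \<subseteq> \<Union>?\<V>"
    proof
      fix v assume "v \<in> V"
      then show "v \<in> \<Union>?\<V>" using ext[of "{v}"] V by auto
    qed
    moreover have j: "\<Union>?\<V> \<subseteq> base X" using sub by blast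
    ultimately have "sat X V \<subseteq> sat_join (cov X) ?\<V>"
      using mono unfolding sat_join_def by blast
    moreover have "sat_join (cov X) ?\<V> \<subseteq> base X"
      "sat X (sat_join (cov X) ?\<V>) = sat_join (cov X) ?\<V>"
      using sub saturation_idem[OF bc j] unfolding sat_join_def by simp_all
    ultimately have "U \<inter> sat X V \<subseteq> sat_circ X U (sat_join (cov X) ?\<V>)"
      using UV by blast
    also have "\<dots> = sat_join (cov X) ((\<lambda>W. sat_circ X U W) ` ?\<V>)"
      using U sub idem by (intro formal_coverD(5)[OF X]) (auto simp: Sat_def)
    also have "\<dots> = sat X (\<Union>v\<in>V. U \<inter> sat X {v})"
      using UV[OF sub idem] unfolding sat_join_def by simp
    finally show ?thesis .
  qed
  fix U V assume U: "U \<subseteq> base X" and V: "V \<subseteq> base X"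
  let ?D = "\<Union>u\<in>U. \<Union>v\<in>V. sat X {u} \<inter> sat X {v}"
  have D: "?D \<subseteq> base X" using sub by blast
  have "sat X U \<inter> sat X {v} \<subseteq> sat X ?D" if v: "v \<in> V" for v
  proof -
    have "sat X {v} \<inter> sat X U \<subseteq> sat X (\<Union>u\<in>U. sat X {v} \<inter> sat X {u})"
      using frame[OF sub _ U] saturation_idem[OF bc, of "{v}"] v V by blast
    also have "\<dots> \<subseteq> sat X ?D"
      using v by (intro mono[OF _ D]) blast
    finally show ?thesis by blast
  qed
  then have "(\<Union>v\<in>V. sat X U \<inter> sat X {v}) \<subseteq> sat X ?D" by blast
  then have "sat X (\<Union>v\<in>V. sat X U \<inter> sat X {v}) \<subseteq> sat X ?D"
    by (rule least[OF D])
  then show "sat X U \<inter> sat X V \<subseteq> sat X ?D"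
    using frame[OF sub saturation_idem[OF bc U] V] by blast
qed

text \<open>
  The meet equation turns monotonicity, associativity and commutativity up to \<open>=\<^sub>\<A>\<close> into those of
  intersection. Distributivity depends on the values \<open>\<A>(U \<circ> V)\<close> alone, which agree with those for
  \<open>\<down>\<close>, so it is inherited from the formal cover given by \<open>\<down>\<close>.
\<close>

lemma formal_cover_iff:
  "formal_cover X \<longleftrightarrow> tri_formal_cover (base X) (cov X) \<and>
     (\<forall>U\<subseteq>base X. \<forall>V\<subseteq>base X. circ X U V \<subseteq> base X \<and> sat X (circ X U V) = sat X U \<inter> sat X V) \<and>
     (\<forall>U V. \<not> (U \<subseteq> base X \<and> V \<subseteq> base X) \<longrightarrow> circ X U V = {})"
    (is "_ \<longleftrightarrow> ?tri \<and> ?meet \<and> ?junk")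
proof
  assume "formal_cover X"
  then show "?tri \<and> ?meet \<and> ?junk"
    by (intro conjI allI impI formal_cover_imp_tri formal_coverD(2-4))
next
  assume *: "?tri \<and> ?meet \<and> ?junk"
  then have tri: "tri_formal_cover (base X) (cov X)"
    and closed: "\<And>U V. U \<subseteq> base X \<Longrightarrow> V \<subseteq> base X \<Longrightarrow> circ X U V \<subseteq> base X"
    and meet: "\<And>U V. U \<subseteq> base X \<Longrightarrow> V \<subseteq> base X \<Longrightarrow> sat X (circ X U V) = sat X U \<inter> sat X V"
    by simp_all
  have junk: "\<forall>U V. \<not> (U \<subseteq> base X \<and> V \<subseteq> base X) \<longrightarrow> circ X U V = {}"
    using * by (elim conjE)
  have bc: "basic_cover (base X) (cov X)"
    using tri unfolding tri_formal_cover_def by (rule conjunct1)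
  define Y where "Y = down_cover (base X) (cov X) (cov_preorder (base X) (cov X))"
  have Y: "formal_cover Y"
    unfolding Y_def by (intro formal_cover_down_cover tri_formal_cover_imp_le tri)
  have [simp]: "base Y = base X" "cov Y = cov X"
    unfolding Y_def down_cover_def by simp_all
  have eq: "sat_circ X U V = sat_circ Y U V" if "U \<subseteq> base X" "V \<subseteq> base X" for U V
    using that meet formal_coverD(4)[OF Y] unfolding sat_circ_def by simp
  have join: "sat_join (cov X) \<V> \<subseteq> base X" for \<V>
    unfolding sat_join_def by (rule saturation_subset[OF bc])
  have joins: "sat_circ X U (sat_join (cov X) \<V>) = sat_join (cov X) ((\<lambda>V. sat_circ X U V) ` \<V>)"
    "sat_circ X (sat_join (cov X) \<V>) U = sat_join (cov X) ((\<lambda>V. sat_circ X V U) ` \<V>)"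
    if "U \<in> Sat (base X) (cov X)" "\<V> \<subseteq> Sat (base X) (cov X)" for U \<V>
  proof -
    have U: "U \<subseteq> base X" and \<V>: "\<And>V. V \<in> \<V> \<Longrightarrow> V \<subseteq> base X"
      using that unfolding Sat_def by blast+
    have Yj: "sat_circ Y U (sat_join (cov X) \<V>) = sat_join (cov X) ((\<lambda>V. sat_circ Y U V) ` \<V>)"
      using formal_coverD(5)[OF Y] that by simp
    show 1: "sat_circ X U (sat_join (cov X) \<V>) = sat_join (cov X) ((\<lambda>V. sat_circ X U V) ` \<V>)"
      using Yj U \<V> join eq by (simp cong: image_cong)
    have comm: "sat_circ X V U = sat_circ X U V" if "V \<subseteq> base X" for V
      unfolding sat_circ_def using meet[OF U that] meet[OF that U] by blast
    show "sat_circ X (sat_join (cov X) \<V>) U = sat_join (cov X) ((\<lambda>V. sat_circ X V U) ` \<V>)"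
      using 1 \<V> comm join by (simp cong: image_cong)
  qed
  have covers_circ: "covers (cov X) (circ X U V) W \<longleftrightarrow> sat X U \<inter> sat X V \<subseteq> sat X W"
    if "U \<subseteq> base X" "V \<subseteq> base X" "W \<subseteq> base X" for U V W
    using meet[OF that(1,2)] saturation_least[OF bc that(3)]
      saturation_extensive[OF bc closed[OF that(1,2)]]
    unfolding covers_iff by blast
  show "formal_cover X"
    unfolding formal_cover_def
    apply (intro conjI allI impI ballI)
    subgoal by (rule bc)
    subgoal by (rule closed)
    subgoal by (rule junk[rule_format])
    subgoal for U1 V1 U2 V2
      using saturation_least[OF bc, of V1 U1] saturation_least[OF bc, of V2 U2]
      by (simp add: covers_circ closed meet covers_iff[of _ U1] covers_iff[of _ U2] le_infI1 le_infI2)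
    subgoal by (auto simp: covers_circ closed meet)
    subgoal by (auto simp: covers_circ closed meet)
    subgoal by (rule joins)
    subgoal by (rule joins)
    subgoal by (rule meet)
    done
qed

section \<open>Inverse images along formal cover maps\<close>

text \<open>
  Inverse image along a basic cover map acts on saturated subsets; the definition asks this only for
  single elements \<open>b \<lhd> V\<close>.
\<close>

lemma basic_cover_map_saturation:
  assumes S: "basic_cover S cv" and r: "basic_cover_map S cv T cw r"
    and V: "V \<subseteq> T" and UV: "U \<subseteq> saturation cw V"
  shows "saturation cv (r\<inverse> `` U) \<subseteq> saturation cv (r\<inverse> `` V)"
proof (rule saturation_least[OF S])
  have rST: "r \<subseteq> S \<times> T"
    and cover: "\<And>b V. b \<in> T \<Longrightarrow> V \<subseteq> T \<Longrightarrow> cw b V \<Longrightarrow> covers cv (r\<inverse> `` {b}) (r\<inverse> `` V)"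
    using r unfolding basic_cover_map_def by blast+
  show "r\<inverse> `` V \<subseteq> S" using rST by blast
  show "r\<inverse> `` U \<subseteq> saturation cv (r\<inverse> `` V)"
  proof
    fix a assume "a \<in> r\<inverse> `` U"
    then obtain b where b: "b \<in> U" "(a, b) \<in> r" by blast
    then have "covers cv (r\<inverse> `` {b}) (r\<inverse> `` V)"
      using cover[of b V] V UV rST unfolding saturation_def by blast
    then show "a \<in> saturation cv (r\<inverse> `` V)" using b unfolding covers_iff by blast
  qed
qed

text \<open>
  Since \<open>\<circ>\<close> is intersection on saturated subsets, a formal cover map is a basic cover map whose
  inverse image preserves the top element and binary meets of generators.
\<close>

lemma formal_cover_map_iff:
  assumes X: "formal_cover X" and Y: "formal_cover Y"
  shows "formal_cover_map X Y r \<longleftrightarrow>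
     basic_cover_map (base X) (cov X) (base Y) (cov Y) r \<and>
     (\<forall>b1\<in>base Y. \<forall>b2\<in>base Y.
        sat X (r\<inverse> `` circ Y {b1} {b2}) = sat X (r\<inverse> `` {b1}) \<inter> sat X (r\<inverse> `` {b2})) \<and>
     base X \<subseteq> sat X (r\<inverse> `` base Y)"
proof (cases "basic_cover_map (base X) (cov X) (base Y) (cov Y) r")
  case True
  then have r: "r\<inverse> `` V \<subseteq> base X" for V unfolding basic_cover_map_def by blast
  note bc = formal_coverD(1)[OF X]
  have "sat X (r\<inverse> `` base Y) = sat X (base X) \<longleftrightarrow> base X \<subseteq> sat X (r\<inverse> `` base Y)"
    using saturation_subset[OF bc] saturation_extensive[OF bc, of "base X"] by blast
  with True show ?thesis
    unfolding formal_cover_map_def using formal_coverD(4)[OF X r r] by simp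
next
  case False
  then show ?thesis unfolding formal_cover_map_def by blast
qed

text \<open>
  Preservation of meets passes from generators to arbitrary subsets because both sides are joins over
  pairs of points: a pair \<open>x \<in> r\<^sup>- u\<close>, \<open>y \<in> r\<^sup>- v\<close> is handled by the hypothesis at \<open>u\<close> and \<open>v\<close>. This is what
  makes formal cover maps compose, as \<open>s\<^sup>- {b}\<close> is in general not a singleton.
\<close>

lemma formal_cover_map_circ:
  assumes X: "formal_cover X" and Y: "formal_cover Y" and r: "formal_cover_map X Y r"
    and U: "U \<subseteq> base Y" and V: "V \<subseteq> base Y"
  shows "sat X (r\<inverse> `` circ Y U V) = sat X (r\<inverse> `` U) \<inter> sat X (r\<inverse> `` V)"
proof
  note bcX = formal_coverD(1)[OF X] and bcY = formal_coverD(1)[OF Y]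
  have bm: "basic_cover_map (base X) (cov X) (base Y) (cov Y) r"
    and pt: "\<And>b1 b2. b1 \<in> base Y \<Longrightarrow> b2 \<in> base Y \<Longrightarrow>
        sat X (r\<inverse> `` circ Y {b1} {b2}) = sat X (r\<inverse> `` {b1}) \<inter> sat X (r\<inverse> `` {b2})"
    using r unfolding formal_cover_map_iff[OF X Y] by blast+
  have rX: "r\<inverse> `` W \<subseteq> base X" for W using bm unfolding basic_cover_map_def by blast
  note inv = basic_cover_map_saturation[OF bcX bm]
  have circ: "circ Y U V \<subseteq> base Y" by (rule formal_coverD(2)[OF Y U V])
  have "circ Y U V \<subseteq> sat Y U \<inter> sat Y V"
    using saturation_extensive[OF bcY circ] formal_coverD(4)[OF Y U V] by simp
  then show "sat X (r\<inverse> `` circ Y U V) \<subseteq> sat X (r\<inverse> `` U) \<inter> sat X (r\<inverse> `` V)"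
    using inv[OF U] inv[OF V] by blast
  have "sat X {x} \<inter> sat X {y} \<subseteq> sat X (r\<inverse> `` circ Y U V)"
    if x: "x \<in> r\<inverse> `` U" and y: "y \<in> r\<inverse> `` V" for x y
  proof -
    obtain u v where u: "u \<in> U" "x \<in> r\<inverse> `` {u}" and v: "v \<in> V" "y \<in> r\<inverse> `` {v}"
      using x y by blast
    have "sat X {x} \<subseteq> sat X (r\<inverse> `` {u})" "sat X {y} \<subseteq> sat X (r\<inverse> `` {v})"
      using u v by (intro saturation_mono[OF bcX _ rX]; blast)+
    then have "sat X {x} \<inter> sat X {y} \<subseteq> sat X (r\<inverse> `` circ Y {u} {v})"
      using pt[of u v] u v U V by blast
    also have "\<dots> \<subseteq> sat X (r\<inverse> `` circ Y U V)"
    proof (rule inv[OF circ])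
      have uv: "{u} \<subseteq> base Y" "{v} \<subseteq> base Y" using u v U V by blast+
      have "sat Y {u} \<subseteq> sat Y U" "sat Y {v} \<subseteq> sat Y V"
        using saturation_mono[OF bcY _ U, of "{u}"] saturation_mono[OF bcY _ V, of "{v}"] u v
        by blast+
      then show "circ Y {u} {v} \<subseteq> sat Y (circ Y U V)"
        using saturation_extensive[OF bcY formal_coverD(2)[OF Y uv]]
          formal_coverD(4)[OF Y uv] formal_coverD(4)[OF Y U V] by blast
    qed
    finally show ?thesis .
  qed
  then have "sat X (\<Union>x\<in>r\<inverse> `` U. \<Union>y\<in>r\<inverse> `` V. sat X {x} \<inter> sat X {y}) \<subseteq> sat X (r\<inverse> `` circ Y U V)"
    by (intro saturation_least[OF bcX rX]) blast
  moreover have "sat X (r\<inverse> `` U) \<inter> sat X (r\<inverse> `` V) \<subseteq>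
      sat X (\<Union>x\<in>r\<inverse> `` U. \<Union>y\<in>r\<inverse> `` V. sat X {x} \<inter> sat X {y})"
    using formal_cover_imp_tri[OF X] rX unfolding tri_formal_cover_iff by blast
  ultimately show "sat X (r\<inverse> `` U) \<inter> sat X (r\<inverse> `` V) \<subseteq> sat X (r\<inverse> `` circ Y U V)" by blast
qed

section \<open>The category of formal covers\<close>

lemma converse_relcomp_Image: "(r O s)\<inverse> `` U = r\<inverse> `` (s\<inverse> `` U)"
  by blast

lemma formal_cover_map_Id_on:
  assumes "formal_cover X" "formal_cover Y" "base Y = base X" "cov Y = cov X"
  shows "formal_cover_map X Y (Id_on (base X))"
proof -
  note bc = formal_coverD(1)[OF assms(1)]
  have im: "(Id_on (base X))\<inverse> `` U = U" if "U \<subseteq> base X" for U using that by auto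
  show ?thesis
    unfolding formal_cover_map_iff[OF assms(1,2)] basic_cover_map_def assms(3,4)
  proof (intro conjI ballI allI impI)
    show "covers (cov X) ((Id_on (base X))\<inverse> `` {b}) ((Id_on (base X))\<inverse> `` V)"
      if "b \<in> base X" "V \<subseteq> base X" "cov X b V" for b V
      using that by (simp only: im) (simp add: im covers_def)
    show "sat X ((Id_on (base X))\<inverse> `` circ Y {b1} {b2}) =
        sat X ((Id_on (base X))\<inverse> `` {b1}) \<inter> sat X ((Id_on (base X))\<inverse> `` {b2})"
      if "b1 \<in> base X" "b2 \<in> base X" for b1 b2
      using formal_coverD(2,4)[OF assms(2), of "{b1}" "{b2}"] that
      by (simp only: im assms(3,4) empty_subsetI insert_subset)
    show "base X \<subseteq> sat X ((Id_on (base X))\<inverse> `` base X)"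
      using saturation_extensive[OF bc, of "base X"] by (simp only: im subset_refl)
  qed auto
qed

lemma formal_cover_map_relcomp:
  assumes X: "formal_cover X" and Y: "formal_cover Y" and Z: "formal_cover Z"
    and r: "formal_cover_map X Y r" and s: "formal_cover_map Y Z s"
  shows "formal_cover_map X Z (r O s)"
proof -
  note bcX = formal_coverD(1)[OF X] and bcY = formal_coverD(1)[OF Y]
  have bm: "basic_cover_map (base X) (cov X) (base Y) (cov Y) r"
    and top_r: "base X \<subseteq> sat X (r\<inverse> `` base Y)"
    using r unfolding formal_cover_map_iff[OF X Y] by blast+
  have bm': "basic_cover_map (base Y) (cov Y) (base Z) (cov Z) s"
    and pt: "\<And>b1 b2. b1 \<in> base Z \<Longrightarrow> b2 \<in> base Z \<Longrightarrow>
        sat Y (s\<inverse> `` circ Z {b1} {b2}) = sat Y (s\<inverse> `` {b1}) \<inter> sat Y (s\<inverse> `` {b2})"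
    and top_s: "base Y \<subseteq> sat Y (s\<inverse> `` base Z)"
    using s unfolding formal_cover_map_iff[OF Y Z] by blast+
  have rs: "r \<subseteq> base X \<times> base Y" "s \<subseteq> base Y \<times> base Z"
    using bm bm' unfolding basic_cover_map_def by blast+
  have im: "s\<inverse> `` W \<subseteq> base Y" for W using rs by blast
  note inv = basic_cover_map_saturation[OF bcX bm]
  have imX: "r\<inverse> `` W \<subseteq> base X" for W using rs by blast
  have inv_eq: "sat X (r\<inverse> `` U) = sat X (r\<inverse> `` V)" if "U \<subseteq> base Y" "V \<subseteq> base Y" "sat Y U = sat Y V" for U V
    using inv[OF that(1), of V] inv[OF that(2), of U] saturation_extensive[OF bcY] that by blast
  show ?thesis
    unfolding formal_cover_map_iff[OF X Z] basic_cover_map_def converse_relcomp_Image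
  proof (intro conjI ballI allI impI)
    show "r O s \<subseteq> base X \<times> base Z" using rs by blast
    show "covers (cov X) (r\<inverse> `` (s\<inverse> `` {b})) (r\<inverse> `` (s\<inverse> `` V))"
      if "b \<in> base Z" "V \<subseteq> base Z" "cov Z b V" for b V
    proof -
      have "covers (cov Y) (s\<inverse> `` {b}) (s\<inverse> `` V)"
        using bm' that unfolding basic_cover_map_def by blast
      then show ?thesis
        using inv[OF im] saturation_extensive[OF bcX imX] unfolding covers_iff by blast
    qed
    show "sat X (r\<inverse> `` (s\<inverse> `` circ Z {b1} {b2})) =
        sat X (r\<inverse> `` (s\<inverse> `` {b1})) \<inter> sat X (r\<inverse> `` (s\<inverse> `` {b2}))"
      if b: "b1 \<in> base Z" "b2 \<in> base Z" for b1 b2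
    proof -
      have "sat Y (s\<inverse> `` circ Z {b1} {b2}) = sat Y (circ Y (s\<inverse> `` {b1}) (s\<inverse> `` {b2}))"
        using pt[OF b] formal_coverD(4)[OF Y im im] by simp
      then show ?thesis
        using inv_eq[OF im formal_coverD(2)[OF Y im im]] formal_cover_map_circ[OF X Y r im im] by simp
    qed
    show "base X \<subseteq> sat X (r\<inverse> `` (s\<inverse> `` base Z))"
      using top_r inv[OF im top_s] by blast
  qed
qed

lemma equiv_fmap_eq: "equiv {r. formal_cover_map X Y r} (fmap_eq X Y)"
  unfolding fmap_eq_def basic_map_eq_def by (rule equivI) (auto simp: refl_on_def sym_def trans_def)

text \<open>
  Inverse images commute with unions, so comparing them at single elements is enough.
\<close>

lemma saturation_inverse_image_cong:
  assumes X: "basic_cover (base X) (cov X)" and rs: "(r, s) \<in> fmap_eq X Y" and U: "U \<subseteq> base Y"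
  shows "sat X (r\<inverse> `` U) = sat X (s\<inverse> `` U)"
proof -
  have *: "sat X (r\<inverse> `` U) \<subseteq> sat X (s\<inverse> `` U)" if rs: "(r, s) \<in> fmap_eq X Y" for r s
  proof (rule saturation_least[OF X])
    have im: "r\<inverse> `` W \<subseteq> base X" "s\<inverse> `` W \<subseteq> base X" for W
      using rs unfolding fmap_eq_def formal_cover_map_def basic_cover_map_def by blast+
    show "s\<inverse> `` U \<subseteq> base X" by (rule im)
    have "r\<inverse> `` {b} \<subseteq> sat X (s\<inverse> `` U)" if "b \<in> U" for b
    proof -
      have "sat X (r\<inverse> `` {b}) = sat X (s\<inverse> `` {b})"
        using rs that U unfolding fmap_eq_def basic_map_eq_def by blast
      moreover have "sat X (s\<inverse> `` {b}) \<subseteq> sat X (s\<inverse> `` U)"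
        using that by (intro saturation_mono[OF X _ im(2)]) blast
      ultimately show ?thesis using saturation_extensive[OF X im(1)] by blast
    qed
    then show "r\<inverse> `` U \<subseteq> sat X (s\<inverse> `` U)" by blast
  qed
  have "(s, r) \<in> fmap_eq X Y" using rs unfolding fmap_eq_def basic_map_eq_def by auto
  then show ?thesis using * rs by blast
qed

lemma fmap_eq_relcomp:
  assumes X: "formal_cover X" and Y: "formal_cover Y" and Z: "formal_cover Z"
    and r: "(r, r') \<in> fmap_eq X Y" and s: "(s, s') \<in> fmap_eq Y Z"
  shows "(r O s, r' O s') \<in> fmap_eq X Z"
proof -
  note bcX = formal_coverD(1)[OF X] and bcY = formal_coverD(1)[OF Y]
  have maps: "formal_cover_map X Y r" "formal_cover_map X Y r'"
      "formal_cover_map Y Z s" "formal_cover_map Y Z s'"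
    and eq: "\<And>b. b \<in> base Z \<Longrightarrow> sat Y (s\<inverse> `` {b}) = sat Y (s'\<inverse> `` {b})"
    using r s unfolding fmap_eq_def basic_map_eq_def by blast+
  have bm: "basic_cover_map (base X) (cov X) (base Y) (cov Y) r'"
    using maps(2) unfolding formal_cover_map_def by blast
  have im: "s\<inverse> `` W \<subseteq> base Y" "s'\<inverse> `` W \<subseteq> base Y" for W
    using maps(3,4) unfolding formal_cover_map_def basic_cover_map_def by blast+
  note inv = basic_cover_map_saturation[OF bcX bm]
  have "sat X (r\<inverse> `` (s\<inverse> `` {b})) = sat X (r'\<inverse> `` (s'\<inverse> `` {b}))" if b: "b \<in> base Z" for b
  proof -
    have "s\<inverse> `` {b} \<subseteq> sat Y (s'\<inverse> `` {b})" "s'\<inverse> `` {b} \<subseteq> sat Y (s\<inverse> `` {b})"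
      using eq[OF b] saturation_extensive[OF bcY im(1), of "{b}"]
        saturation_extensive[OF bcY im(2), of "{b}"] by blast+
    then have "sat X (r'\<inverse> `` (s\<inverse> `` {b})) = sat X (r'\<inverse> `` (s'\<inverse> `` {b}))"
      using inv[OF im(1)] inv[OF im(2)] by blast
    then show ?thesis using saturation_inverse_image_cong[OF bcX r im(1)] by simp
  qed
  then show ?thesis
    unfolding fmap_eq_def basic_map_eq_def
    using formal_cover_map_relcomp[OF X Y Z] maps by (simp add: converse_relcomp_Image)
qed

lemma FCov_simps:
  "Ob FCov = {X. formal_cover X}"
  "Hom FCov X Y = {r. formal_cover_map X Y r} // fmap_eq X Y"
  "Id FCov X = fmap_eq X X `` {Id_on (base X)}"
  unfolding FCov_def by simp_all

lemma FCov_HomE: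
  assumes "f \<in> Hom FCov X Y"
  obtains r where "formal_cover_map X Y r" "f = fmap_eq X Y `` {r}"
  using assms unfolding FCov_simps by (auto elim: quotientE)

lemma FCov_HomI: "formal_cover_map X Y r \<Longrightarrow> fmap_eq X Y `` {r} \<in> Hom FCov X Y"
  unfolding FCov_simps by (simp add: quotientI)

text \<open>
  The union over all representatives collapses to a single class, since they all give the same one.
\<close>

lemma FCov_Comp:
  assumes XYZ: "formal_cover X" "formal_cover Y" "formal_cover Z"
    and r: "formal_cover_map X Y r" and s: "formal_cover_map Y Z s"
  shows "Comp FCov X Y Z (fmap_eq Y Z `` {s}) (fmap_eq X Y `` {r}) = fmap_eq X Z `` {r O s}"
proof -
  let ?A = "fmap_eq X Y `` {r}" and ?B = "fmap_eq Y Z `` {s}" and ?C = "fmap_eq X Z `` {r O s}"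
  have eq: "fmap_eq X Z `` {r' O s'} = ?C" if "r' \<in> ?A" "s' \<in> ?B" for r' s'
    using equiv_class_eq[OF equiv_fmap_eq fmap_eq_relcomp[OF XYZ, of r r' s s']] that by simp
  have "r \<in> ?A" "s \<in> ?B"
    using r s unfolding fmap_eq_def basic_map_eq_def by simp_all
  then have "(\<Union>r'\<in>?A. \<Union>s'\<in>?B. ?C) = ?C" by blast
  moreover have "(\<Union>r'\<in>?A. \<Union>s'\<in>?B. fmap_eq X Z `` {r' O s'}) = (\<Union>r'\<in>?A. \<Union>s'\<in>?B. ?C)"
    by (intro SUP_cong refl eq)
  ultimately show ?thesis unfolding FCov_def by simp
qed

lemma category_FCov: "category FCov"
  unfolding category_def
proof (intro conjI ballI)
  fix W X Y Z :: "'a fcover" and f g h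
  assume "W \<in> Ob FCov" and "X \<in> Ob FCov" and "Y \<in> Ob FCov" and "Z \<in> Ob FCov"
  then have W: "formal_cover W" and X: "formal_cover X" and Y: "formal_cover Y"
    and Z: "formal_cover Z" by (simp_all add: FCov_simps)
  note comp = formal_cover_map_relcomp
  assume "f \<in> Hom FCov W X" "g \<in> Hom FCov X Y" "h \<in> Hom FCov Y Z"
  then obtain r s t where r: "formal_cover_map W X r" "f = fmap_eq W X `` {r}"
    and s: "formal_cover_map X Y s" "g = fmap_eq X Y `` {s}"
    and t: "formal_cover_map Y Z t" "h = fmap_eq Y Z `` {t}"
    by (elim FCov_HomE)
  show "Comp FCov W X Z (Comp FCov X Y Z h g) f = Comp FCov W Y Z h (Comp FCov W X Y g f)"
    using r s t W X Y Z by (simp add: FCov_Comp comp[of W X Y] comp[of X Y Z] O_assoc)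
next
  fix X :: "'a fcover" assume "X \<in> Ob FCov"
  then show "Id FCov X \<in> Hom FCov X X"
    using FCov_HomI[OF formal_cover_map_Id_on[of X X]] by (simp add: FCov_simps)
next
  fix X Y Z :: "'a fcover" and f g
  assume "X \<in> Ob FCov" and "Y \<in> Ob FCov" and "Z \<in> Ob FCov"
    and "f \<in> Hom FCov X Y" "g \<in> Hom FCov Y Z"
  then show "Comp FCov X Y Z g f \<in> Hom FCov X Z"
    using FCov_HomI[OF formal_cover_map_relcomp[of X Y Z]]
    by (auto elim!: FCov_HomE simp: FCov_Comp FCov_simps(1))
next
  fix X Y :: "'a fcover" and f
  assume "X \<in> Ob FCov" and "Y \<in> Ob FCov" and "f \<in> Hom FCov X Y"
  then have X: "formal_cover X" and Y: "formal_cover Y" by (simp_all add: FCov_simps)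
  obtain r where r: "formal_cover_map X Y r" "f = fmap_eq X Y `` {r}"
    using \<open>f \<in> Hom FCov X Y\<close> by (elim FCov_HomE)
  have "r \<subseteq> base X \<times> base Y"
    using r unfolding formal_cover_map_def basic_cover_map_def by blast
  then have "Id_on (base X) O r = r" "r O Id_on (base Y) = r" by auto
  then show "Comp FCov X X Y f (Id FCov X) = f" "Comp FCov X Y Y (Id FCov Y) f = f"
    using r X Y formal_cover_map_Id_on[OF X X] formal_cover_map_Id_on[OF Y Y]
    by (simp_all add: FCov_simps FCov_Comp)
qed

text \<open>
  Equality of arrows is tested on saturated inverse images of elements, so mutually inverse relations
  only have to be inverse to each other up to saturation.
\<close>

lemma iso_arrow_FCovI:
  assumes X: "formal_cover X" and Y: "formal_cover Y"
    and r: "formal_cover_map X Y r" and s: "formal_cover_map Y X s"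
    and rs: "\<And>a. a \<in> base X \<Longrightarrow> sat X (r\<inverse> `` (s\<inverse> `` {a})) = sat X {a}"
    and sr: "\<And>b. b \<in> base Y \<Longrightarrow> sat Y (s\<inverse> `` (r\<inverse> `` {b})) = sat Y {b}"
  shows "iso_arrow FCov X Y (fmap_eq X Y `` {r})"
proof -
  have Id: "(Id_on (base Z))\<inverse> `` {b} = {b}" if "b \<in> base Z" for b and Z :: "'a fcover"
    using that by auto
  have "(r O s, Id_on (base X)) \<in> fmap_eq X X" "(s O r, Id_on (base Y)) \<in> fmap_eq Y Y"
    unfolding fmap_eq_def basic_map_eq_def
    using formal_cover_map_relcomp[OF X Y X r s] formal_cover_map_relcomp[OF Y X Y s r]
      formal_cover_map_Id_on[OF X X] formal_cover_map_Id_on[OF Y Y]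
    by (auto simp: converse_relcomp_Image rs sr Id)
  then have "fmap_eq X X `` {r O s} = Id FCov X" "fmap_eq Y Y `` {s O r} = Id FCov Y"
    unfolding FCov_simps by (auto intro!: equiv_class_eq[OF equiv_fmap_eq])
  then show ?thesis
    unfolding iso_arrow_def using FCov_HomI[OF r] FCov_HomI[OF s]
      FCov_Comp[OF X Y X r s] FCov_Comp[OF Y X Y s r] by auto
qed

text \<open>
  The operation of a formal cover is determined by its cover up to saturation, so changing it does not
  change the isomorphism class.
\<close>

lemma iso_arrow_FCov_same_cov:
  assumes "formal_cover X" "formal_cover Y" "base Y = base X" "cov Y = cov X"
  shows "iso_arrow FCov X Y (fmap_eq X Y `` {Id_on (base X)})"
proof (rule iso_arrow_FCovI[OF assms(1,2) formal_cover_map_Id_on[OF assms]])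
  show "formal_cover_map Y X (Id_on (base X))"
    using formal_cover_map_Id_on[OF assms(2,1)] assms(3,4) by simp
qed (auto simp: assms(3) Id_on_def intro!: arg_cong[of _ _ "saturation _"])

section \<open>Covers presented by a generating meet-semilattice\<close>

text \<open>
  The elements of \<open>T\<close> name saturated subsets of \<open>X\<close>. The assumption \<open>generate\<close> says that these subsets
  generate the frame of saturated subsets under joins, and \<open>dot\<close> computes names of binary meets. A
  subset may have several names.
\<close>

locale meet_generators =
  fixes X :: "'a fcover" and T :: "'a set" and m :: "'a \<Rightarrow> 'a set" and dot :: "'a \<Rightarrow> 'a \<Rightarrow> 'a"
  assumes X: "formal_cover X"
    and m_sub: "t \<in> T \<Longrightarrow> m t \<subseteq> base X"
    and m_sat: "t \<in> T \<Longrightarrow> sat X (m t) = m t"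
    and generate: "x \<in> base X \<Longrightarrow> x \<in> sat X (\<Union>t\<in>{t\<in>T. m t \<subseteq> sat X {x}}. m t)"
    and dot_in: "t \<in> T \<Longrightarrow> u \<in> T \<Longrightarrow> dot t u \<in> T"
    and m_dot: "t \<in> T \<Longrightarrow> u \<in> T \<Longrightarrow> m (dot t u) = m t \<inter> m u"
begin

text \<open>
  A name is covered by a set of names when this holds for the saturated subsets in the frame of \<open>X\<close>.
\<close>

definition presented :: "'a fcover" where
  "presented = \<lparr>base = T,
     cov = (\<lambda>t U. t \<in> T \<and> U \<subseteq> T \<and> m t \<subseteq> sat X (\<Union>(m ` U))),
     circ = (\<lambda>U V. if U \<subseteq> T \<and> V \<subseteq> T then (\<Union>u\<in>U. \<Union>v\<in>V. {dot u v}) else {})\<rparr>"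

lemma base_presented [simp]: "base presented = T"
  unfolding presented_def by simp

lemma circ_presented: "U \<subseteq> T \<Longrightarrow> V \<subseteq> T \<Longrightarrow> circ presented U V = (\<Union>u\<in>U. \<Union>v\<in>V. {dot u v})"
  unfolding presented_def by simp

lemma cov_presented:
  "cov presented t U \<longleftrightarrow> t \<in> T \<and> U \<subseteq> T \<and> m t \<subseteq> sat X (\<Union>(m ` U))"
  unfolding presented_def by simp

lemma sat_presented: "U \<subseteq> T \<Longrightarrow> sat presented U = {t \<in> T. m t \<subseteq> sat X (\<Union>(m ` U))}"
  unfolding saturation_def[of "cov presented"] cov_presented by blast

lemmas bcX = formal_coverD(1)[OF X]

lemma Union_m_sub: "U \<subseteq> T \<Longrightarrow> \<Union>(m ` U) \<subseteq> base X"
  using m_sub by blast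

lemma basic_cover_presented: "basic_cover T (cov presented)"
  unfolding basic_cover_def
proof (intro conjI allI ballI impI)
  fix t U assume "U \<subseteq> T" "t \<in> U"
  then show "cov presented t U"
    unfolding cov_presented using saturation_extensive[OF bcX Union_m_sub] by blast
next
  fix t U V assume U: "U \<subseteq> T" and V: "V \<subseteq> T" and t: "cov presented t U" and *: "\<forall>u\<in>U. cov presented u V"
  then have "\<Union>(m ` U) \<subseteq> sat X (\<Union>(m ` V))" unfolding cov_presented by blast
  then have "sat X (\<Union>(m ` U)) \<subseteq> sat X (\<Union>(m ` V))"
    by (rule saturation_least[OF bcX Union_m_sub[OF V]])
  then show "cov presented t V" using t V unfolding cov_presented by blast
qed (simp_all add: cov_presented)

text \<open>
  By the frame law of \<open>X\<close>, the meet of two joins of named subsets is the join of the pairwise meets,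
  and these are named by \<open>dot\<close>.
\<close>

lemma sat_Union_m_circ:
  assumes U: "U \<subseteq> T" and V: "V \<subseteq> T"
  shows "sat X (\<Union>(m ` circ presented U V)) = sat X (\<Union>(m ` U)) \<inter> sat X (\<Union>(m ` V))"
proof
  have UV: "\<Union>(m ` circ presented U V) = (\<Union>u\<in>U. \<Union>v\<in>V. m u \<inter> m v)"
    using U V by (auto simp: circ_presented m_dot subset_iff)
  have sub: "(\<Union>u\<in>U. \<Union>v\<in>V. m u \<inter> m v) \<subseteq> base X" using U m_sub by blast
  show "sat X (\<Union>(m ` circ presented U V)) \<subseteq> sat X (\<Union>(m ` U)) \<inter> sat X (\<Union>(m ` V))"
    unfolding UV
    by (intro Int_greatest saturation_mono[OF bcX _ Union_m_sub[OF U]]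
        saturation_mono[OF bcX _ Union_m_sub[OF V]]) blast+
  have point: "sat X {x} \<subseteq> m t" if "x \<in> m t" "t \<in> T" for x t
    using saturation_mono[OF bcX, of "{x}" "m t"] m_sub[OF that(2)] m_sat[OF that(2)] that(1) by blast
  have "(\<Union>x\<in>\<Union>(m ` U). \<Union>y\<in>\<Union>(m ` V). sat X {x} \<inter> sat X {y}) \<subseteq> (\<Union>u\<in>U. \<Union>v\<in>V. m u \<inter> m v)"
  proof
    fix a assume "a \<in> (\<Union>x\<in>\<Union>(m ` U). \<Union>y\<in>\<Union>(m ` V). sat X {x} \<inter> sat X {y})"
    then obtain u v x y where u: "u \<in> U" "x \<in> m u" and v: "v \<in> V" "y \<in> m v"
      and a: "a \<in> sat X {x}" "a \<in> sat X {y}" by blast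
    then have "a \<in> m u" "a \<in> m v"
      using point[OF u(2)] point[OF v(2)] U V by blast+
    then show "a \<in> (\<Union>u\<in>U. \<Union>v\<in>V. m u \<inter> m v)" using u v by blast
  qed
  then have "sat X (\<Union>x\<in>\<Union>(m ` U). \<Union>y\<in>\<Union>(m ` V). sat X {x} \<inter> sat X {y}) \<subseteq>
      sat X (\<Union>u\<in>U. \<Union>v\<in>V. m u \<inter> m v)"
    by (rule saturation_mono[OF bcX _ sub])
  moreover have "sat X (\<Union>(m ` U)) \<inter> sat X (\<Union>(m ` V)) \<subseteq>
      sat X (\<Union>x\<in>\<Union>(m ` U). \<Union>y\<in>\<Union>(m ` V). sat X {x} \<inter> sat X {y})"
    using formal_cover_imp_tri[OF X] Union_m_sub[OF U] Union_m_sub[OF V]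
    unfolding tri_formal_cover_iff by blast
  ultimately show "sat X (\<Union>(m ` U)) \<inter> sat X (\<Union>(m ` V)) \<subseteq> sat X (\<Union>(m ` circ presented U V))"
    unfolding UV by blast
qed

lemma circ_presented_sub: "U \<subseteq> T \<Longrightarrow> V \<subseteq> T \<Longrightarrow> circ presented U V \<subseteq> T"
  using dot_in by (auto simp: circ_presented)

lemma sat_circ_presented:
  assumes "U \<subseteq> T" "V \<subseteq> T"
  shows "sat presented (circ presented U V) = sat presented U \<inter> sat presented V"
  using sat_Union_m_circ[OF assms] assms circ_presented_sub[OF assms] by (auto simp: sat_presented)

lemma formal_cover_presented: "formal_cover presented"
  unfolding formal_cover_iff base_presented
proof (intro conjI allI impI)
  show "tri_formal_cover T (cov presented)"
    unfolding tri_formal_cover_iff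
  proof (intro conjI allI impI)
    show bc: "basic_cover T (cov presented)" by (rule basic_cover_presented)
    fix U V assume U: "U \<subseteq> T" and V: "V \<subseteq> T"
    have "dot u v \<in> sat presented {u} \<inter> sat presented {v}" if "u \<in> U" "v \<in> V" for u v
    proof -
      have uv: "u \<in> T" "v \<in> T" using that U V by blast+
      then have "circ presented {u} {v} = {dot u v}" by (simp add: circ_presented)
      then show ?thesis
        using sat_circ_presented[of "{u}" "{v}"] uv dot_in[OF uv]
          saturation_extensive[OF bc, of "{dot u v}"] by auto
    qed
    then have "circ presented U V \<subseteq> (\<Union>u\<in>U. \<Union>v\<in>V. sat presented {u} \<inter> sat presented {v})"
      using U V by (auto simp: circ_presented)
    moreover have "(\<Union>u\<in>U. \<Union>v\<in>V. sat presented {u} \<inter> sat presented {v}) \<subseteq> T"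
      using saturation_subset[OF bc] by blast
    ultimately show "sat presented U \<inter> sat presented V \<subseteq>
        sat presented (\<Union>u\<in>U. \<Union>v\<in>V. sat presented {u} \<inter> sat presented {v})"
      unfolding sat_circ_presented[OF U V, symmetric] by (rule saturation_mono[OF bc])
  qed
  show "circ presented U V = {}" if "\<not> (U \<subseteq> T \<and> V \<subseteq> T)" for U V
    using that unfolding presented_def by auto
qed (simp_all add: circ_presented_sub sat_circ_presented)

lemma bullet_formal_cover_presented: "bullet_formal_cover presented dot"
  unfolding bullet_formal_cover_def using formal_cover_presented dot_in by (simp add: circ_presented)

text \<open>
  The two relations read a name as the subset of points it contains, and a point \<open>x\<close> as the set of
  names of subsets of \<open>\<A>{x}\<close>.
\<close>

definition to_presented :: "('a \<times> 'a) set" where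
  "to_presented = {(x, t). t \<in> T \<and> x \<in> m t}"

definition from_presented :: "('a \<times> 'a) set" where
  "from_presented = {(t, x). t \<in> T \<and> x \<in> base X \<and> m t \<subseteq> sat X {x}}"

lemma to_presented_image: "U \<subseteq> T \<Longrightarrow> to_presented\<inverse> `` U = \<Union>(m ` U)"
  unfolding to_presented_def by blast

lemma from_presented_sub: "from_presented\<inverse> `` V \<subseteq> T"
  unfolding from_presented_def by blast

text \<open>
  Reading points as names and then names as subsets gives back the same saturated subset. The
  inclusion from right to left is what \<open>generate\<close> says. Together with the description of \<open>\<lhd>\<close> on names it also yields all the
  properties of \<open>from_presented\<close>.
\<close>

lemma sat_Union_from_presented:
  assumes V: "V \<subseteq> base X"
  shows "sat X (\<Union>(m ` (from_presented\<inverse> `` V))) = sat X V"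
proof
  have sub: "\<Union>(m ` (from_presented\<inverse> `` V)) \<subseteq> base X"
    by (rule Union_m_sub[OF from_presented_sub])
  have "m t \<subseteq> sat X V" if t: "t \<in> from_presented\<inverse> `` V" for t
  proof -
    obtain x where "x \<in> V" "m t \<subseteq> sat X {x}" using t unfolding from_presented_def by blast
    then show ?thesis using saturation_mono[OF bcX _ V, of "{x}"] by blast
  qed
  then show "sat X (\<Union>(m ` (from_presented\<inverse> `` V))) \<subseteq> sat X V"
    by (intro saturation_least[OF bcX V]) blast
  show "sat X V \<subseteq> sat X (\<Union>(m ` (from_presented\<inverse> `` V)))"
  proof (rule saturation_least[OF bcX sub], rule subsetI)
    fix x assume x: "x \<in> V"
    then have "x \<in> sat X (\<Union>t\<in>{t\<in>T. m t \<subseteq> sat X {x}}. m t)"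
      using generate V by blast
    also have "\<dots> \<subseteq> sat X (\<Union>(m ` (from_presented\<inverse> `` V)))"
      using x V unfolding from_presented_def
      by (intro saturation_mono[OF bcX _ sub[unfolded from_presented_def]]) blast
    finally show "x \<in> sat X (\<Union>(m ` (from_presented\<inverse> `` V)))" .
  qed
qed

lemma sat_from_presented:
  "V \<subseteq> base X \<Longrightarrow> sat presented (from_presented\<inverse> `` V) = {t \<in> T. m t \<subseteq> sat X V}"
  by (simp add: sat_presented from_presented_sub sat_Union_from_presented)

lemma m_in_base: "t \<in> T \<Longrightarrow> x \<in> m t \<Longrightarrow> x \<in> base X"
  using m_sub by blast

lemma formal_cover_map_to_presented: "formal_cover_map X presented to_presented"
  unfolding formal_cover_map_iff[OF X formal_cover_presented] basic_cover_map_def base_presented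
proof (intro conjI ballI allI impI)
  show "to_presented \<subseteq> base X \<times> T" unfolding to_presented_def using m_in_base by blast
  show "covers (cov X) (to_presented\<inverse> `` {t}) (to_presented\<inverse> `` V)"
    if "t \<in> T" "V \<subseteq> T" "cov presented t V" for t V
    using that by (simp add: to_presented_image covers_iff cov_presented)
  show "sat X (to_presented\<inverse> `` circ presented {t} {u}) =
      sat X (to_presented\<inverse> `` {t}) \<inter> sat X (to_presented\<inverse> `` {u})" if "t \<in> T" "u \<in> T" for t u
    using sat_Union_m_circ[of "{t}" "{u}"] that
    by (simp add: to_presented_image circ_presented_sub)
  show "base X \<subseteq> sat X (to_presented\<inverse> `` T)"
  proof
    fix x assume "x \<in> base X"
    then have "x \<in> sat X (\<Union>t\<in>{t\<in>T. m t \<subseteq> sat X {x}}. m t)" by (rule generate)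
    also have "\<dots> \<subseteq> sat X (\<Union>(m ` T))"
      by (rule saturation_mono[OF bcX _ Union_m_sub]) auto
    finally show "x \<in> sat X (to_presented\<inverse> `` T)" by (simp add: to_presented_image)
  qed
qed

lemma formal_cover_map_from_presented: "formal_cover_map presented X from_presented"
  unfolding formal_cover_map_iff[OF formal_cover_presented X] basic_cover_map_def base_presented
proof (intro conjI ballI allI impI)
  show "from_presented \<subseteq> T \<times> base X" unfolding from_presented_def by blast
  show "covers (cov presented) (from_presented\<inverse> `` {x}) (from_presented\<inverse> `` V)"
    if "x \<in> base X" "V \<subseteq> base X" "cov X x V" for x V
  proof -
    have "sat X {x} \<subseteq> sat X V"
      using saturation_least[OF bcX that(2), of "{x}"] that(3) by (simp add: saturation_def)
    then show ?thesis
      unfolding covers_iff sat_from_presented[OF that(2)] unfolding from_presented_def by blast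
  qed
  show "sat presented (from_presented\<inverse> `` circ X {x} {y}) =
      sat presented (from_presented\<inverse> `` {x}) \<inter> sat presented (from_presented\<inverse> `` {y})"
    if "x \<in> base X" "y \<in> base X" for x y
    using formal_coverD(2,4)[OF X, of "{x}" "{y}"] that by (auto simp: sat_from_presented)
  show "T \<subseteq> sat presented (from_presented\<inverse> `` base X)"
    using saturation_extensive[OF bcX, of "base X"] m_sub by (auto simp: sat_from_presented)
qed

theorem iso_arrow_presented:
  "iso_arrow FCov X presented (fmap_eq X presented `` {to_presented})"
proof (rule iso_arrow_FCovI[OF X formal_cover_presented formal_cover_map_to_presented
      formal_cover_map_from_presented])
  fix x assume "x \<in> base X"
  then show "sat X (to_presented\<inverse> `` (from_presented\<inverse> `` {x})) = sat X {x}"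
    using sat_Union_from_presented[of "{x}"] by (simp add: to_presented_image from_presented_sub)
next
  fix t assume "t \<in> base presented"
  then show "sat presented (from_presented\<inverse> `` (to_presented\<inverse> `` {t})) = sat presented {t}"
    using m_sub[of t] by (simp add: to_presented_image sat_from_presented sat_presented)
qed

end

section \<open>Every formal cover is isomorphic to one of each kind\<close>

lemma ex_iso_tri_formal_cover:
  assumes X: "formal_cover X"
  shows "\<exists>Y f. formal_cover Y \<and> iso_arrow FCov X Y f \<and>
    (\<exists>S cv. tri_formal_cover S cv \<and> Y = down_cover S cv (cov_preorder S cv))"
proof -
  let ?Y = "down_cover (base X) (cov X) (cov_preorder (base X) (cov X))"
  have tri: "tri_formal_cover (base X) (cov X)" by (rule formal_cover_imp_tri[OF X])
  then have Y: "formal_cover ?Y" by (intro formal_cover_down_cover tri_formal_cover_imp_le)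
  moreover have "base ?Y = base X" "cov ?Y = cov X" unfolding down_cover_def by simp_all
  ultimately show ?thesis using iso_arrow_FCov_same_cov[OF X] tri by blast
qed

text \<open>
  The finite nonempty subsets of the base, as names of finite meets of generators, are closed under
  union and hence have binary meets. An infinite type has as many finite subsets as elements, so the names
  fit into the ambient type.
\<close>

lemma ex_iso_bullet_formal_cover:
  fixes X :: "'a fcover"
  assumes inf: "infinite (UNIV :: 'a set)" and X: "formal_cover X"
  shows "\<exists>Y f dot. iso_arrow FCov X Y f \<and> bullet_formal_cover Y dot"
proof -
  obtain code :: "'a set \<Rightarrow> 'a" where code: "inj_on code (Fpow UNIV)"
    using eqpoll_Fpow[OF inf] unfolding eqpoll_def bij_betw_def by blast
  define dec where "dec = inv_into (Fpow UNIV) code"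
  have dec: "dec (code F) = F" if "finite F" for F
    using inv_into_f_f[OF code] that unfolding dec_def Fpow_def by simp
  \<comment> \<open>the empty set is left out, as an empty intersection is the whole ambient type and not a subset of the base\<close>
  define \<F> where "\<F> = {F. finite F \<and> F \<noteq> {} \<and> F \<subseteq> base X}"
  define m where "m t = (\<Inter>x\<in>dec t. sat X {x})" for t
  note bc = formal_coverD(1)[OF X]
  have m_code: "m (code F) = (\<Inter>x\<in>F. sat X {x})" if "F \<in> \<F>" for F
    using that dec unfolding m_def \<F>_def by simp
  interpret meet_generators X "code ` \<F>" m "\<lambda>t u. code (dec t \<union> dec u)"
  proof
    show "formal_cover X" by (rule X)
    fix t assume "t \<in> code ` \<F>"
    then obtain F where t: "t = code F" and F: "F \<in> \<F>" by blast
    have m: "m t = (\<Inter>x\<in>F. sat X {x})" using m_code[OF F] t by simp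
    have F': "F \<noteq> {}" "F \<subseteq> base X" using F unfolding \<F>_def by auto
    show sub: "m t \<subseteq> base X" unfolding m using F' saturation_subset[OF bc] by blast
    have "sat X (m t) \<subseteq> sat X {x}" if "x \<in> F" for x
      using saturation_least[OF bc, of "{x}" "m t"] that F' unfolding m by blast
    then have "sat X (m t) \<subseteq> m t" unfolding m by blast
    then show "sat X (m t) = m t" using saturation_extensive[OF bc sub] by blast
    fix u assume "u \<in> code ` \<F>"
    then obtain G where u: "u = code G" and G: "G \<in> \<F>" by blast
    have FG: "F \<union> G \<in> \<F>" and d: "dec t = F" "dec u = G"
      using F G t u dec unfolding \<F>_def by auto
    show "code (dec t \<union> dec u) \<in> code ` \<F>" using FG d by simp
    show "m (code (dec t \<union> dec u)) = m t \<inter> m u"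
      using m_code[OF FG] m_code[OF F] m_code[OF G] by (auto simp: t u d[unfolded t u])
  next
    fix x assume x: "x \<in> base X"
    then have xF: "{x} \<in> \<F>" unfolding \<F>_def by simp
    let ?W = "\<Union>t\<in>{t \<in> code ` \<F>. m t \<subseteq> sat X {x}}. m t"
    have "x \<in> sat X {x}" using saturation_extensive[OF bc, of "{x}"] x by blast
    then have "x \<in> ?W" using m_code[OF xF] xF by auto
    moreover have "?W \<subseteq> base X" using saturation_subset[OF bc] by blast
    ultimately show "x \<in> sat X ?W" using saturation_extensive[OF bc] by blast
  qed
  show ?thesis using iso_arrow_presented bullet_formal_cover_presented by blast
qed

theorem corollary6p13:
  assumes "infinite (UNIV :: 'a set)"
  shows "equivalent_categories (bullet_FCov :: 'a fcov_cat) (tri_FCov :: 'a fcov_cat) \<and>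
         equivalent_categories (bullet_FCov :: 'a fcov_cat) (FCov :: 'a fcov_cat) \<and>
         equivalent_categories (bullet_FCov :: 'a fcov_cat) (le_FCov :: 'a fcov_cat)"
proof -
  let ?bullet = "\<lambda>X :: 'a fcover. \<exists>dot. bullet_formal_cover X dot"
    and ?tri = "\<lambda>X :: 'a fcover. \<exists>S cv. tri_formal_cover S cv \<and> X = down_cover S cv (cov_preorder S cv)"
    and ?le = "\<lambda>X :: 'a fcover. \<exists>S cv le. le_formal_cover S cv le \<and> X = down_cover S cv le"
  have bullet: "\<exists>Y\<in>Ob FCov. ?bullet Y \<and> (\<exists>f. iso_arrow FCov X Y f)" if "X \<in> Ob FCov" for X
    using ex_iso_bullet_formal_cover[OF assms, of X] that
    unfolding bullet_formal_cover_def FCov_simps by blast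
  have tri: "\<exists>Y\<in>Ob FCov. ?tri Y \<and> (\<exists>f. iso_arrow FCov X Y f)" if "X \<in> Ob FCov" for X
    using ex_iso_tri_formal_cover[of X] that unfolding FCov_simps by blast
  have le: "\<exists>Y\<in>Ob FCov. ?le Y \<and> (\<exists>f. iso_arrow FCov X Y f)" if "X \<in> Ob FCov" for X
    using tri[OF that] tri_formal_cover_imp_le by metis
  \<comment> \<open>the category \<open>FCov\<close> is treated as a full subcategory of itself\<close>
  have all: "\<exists>Y\<in>Ob FCov. True \<and> (\<exists>f. iso_arrow FCov X Y f)" if "X \<in> Ob FCov" for X :: "'a fcover"
    using tri[OF that] by blast
  have FCov_full: "FCov = full_subcategory FCov (\<lambda>X. True)"
    unfolding full_subcategory_def by simp
  note equiv = equivalent_full_subcategories[OF category_FCov, of ?bullet]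
  have "equivalent_categories (bullet_FCov :: 'a fcov_cat) (full_subcategory FCov (\<lambda>X :: 'a fcover. True))"
    unfolding bullet_FCov_def by (rule equiv; erule all bullet)
  then show ?thesis
    using equiv[of ?tri, OF tri bullet] equiv[of ?le, OF le bullet]
    unfolding bullet_FCov_def tri_FCov_def le_FCov_def FCov_full[symmetric] by blast
qed

end
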